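(* Let $(M,J,g)$ be a metallic pseudo-Riemannian manifold and let $\nabla$ be a torsion-free linear connection on $M$. If $\nabla$ is a $J$-connection and $(\nabla,g)$ is Codazzi-coupled, then $\Phi_J g=0$. Furthermore, $(M,J,g)$ is a locally metallic pseudo-Riemannian manifold.
   Context: $X,Y,Z$ denote arbitrary smooth vector fields on $M$. A metallic structure on a smooth manifold $M$ is a $(1,1)$-tensor field $J$, which is a bundle isomorphism $TM\to TM$, such that $J^2=pJ+qI$ for some real numbers $p,q$ ($I$ the identity). A metallic pseudo-Riemannian manifold $(M,J,g)$ is a pseudo-Riemannian manifold $(M,g)$ with a metallic structure $J$ that is $g$-symmetric: $g(JX,Y)=g(X,JY)$. A linear connection $\nabla$ is a $J$-connection if $\nabla J=0$. $(M,J,g)$ is locally metallic pseudo-Riemannian if the Levi-Civita connection $\nabla^g$ of $g$ satisfies $\nabla^gJ=0$. The pair $(\nabla,g)$ is Codazzi-coupled if $(\nabla_Xg)(Y,Z)=(\nabla_Zg)(X,Y)$ for all $X,Y,Z$. The Tachibana operator applied to $g$ is $$(\Phi_Jg)(X,Y,Z)=(JX)\big(g(Y,Z)\big)-X\big(g(JY,Z)\big)+g\big((L_YJ)X,Z\big)+g\big(Y,(L_ZJ)X\big),$$ where $(L_XJ)Y=[X,JY]-J[X,Y]$. *)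

theory Defs
  imports "HOL-Analysis.Analysis"
begin

text \<open>
  \<^const>\<open>differentiable\<close> and \<^const>\<open>frechet_derivative\<close> are taken at points of the full space, so
  the next two notions are only meant for open sets \<open>S\<close>.
\<close>

primrec Ck_on :: "nat \<Rightarrow> 'e::real_normed_vector set \<Rightarrow> ('e \<Rightarrow> 'f::real_normed_vector) \<Rightarrow> bool" where
  "Ck_on 0 S f \<longleftrightarrow> continuous_on S f"
| "Ck_on (Suc k) S f \<longleftrightarrow>
     (\<forall>x\<in>S. f differentiable (at x)) \<and> (\<forall>v. Ck_on k S (\<lambda>x. frechet_derivative f (at x) v))"

definition smooth_on :: "'e::real_normed_vector set \<Rightarrow> ('e \<Rightarrow> 'f::real_normed_vector) \<Rightarrow> bool" where
  "smooth_on S f \<longleftrightarrow> (\<forall>k. Ck_on k S f)"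

type_synonym ('a, 'n) chart = "'a set \<times> ('a \<Rightarrow> real ^ 'n)"

definition is_chart :: "('a::topological_space, 'n::finite) chart \<Rightarrow> bool" where
  "is_chart c \<longleftrightarrow> (case c of (U, \<phi>) \<Rightarrow>
     open U \<and> open (\<phi> ` U) \<and> inj_on \<phi> U \<and> homeomorphism U (\<phi> ` U) \<phi> (inv_into U \<phi>))"

text \<open>
  The manifold is the whole Hausdorff, second countable space \<open>'a\<close>; its dimension is \<open>CARD('n)\<close>.
  The atlas need not be maximal: it is contained in exactly one maximal atlas, and all notions
  below depend only on that one.
\<close>

definition smooth_atlas ::
  "('a::{t2_space, second_countable_topology}, 'n::finite) chart set \<Rightarrow> bool" where
  "smooth_atlas A \<longleftrightarrow>
     (\<forall>c\<in>A. is_chart c) \<and>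
     (\<Union>(U, \<phi>)\<in>A. U) = UNIV \<and>
     (\<forall>(U, \<phi>)\<in>A. \<forall>(V, \<psi>)\<in>A. smooth_on (\<phi> ` (U \<inter> V)) (\<psi> \<circ> inv_into U \<phi>))"

definition smooth_functions ::
  "('a::topological_space, 'n::finite) chart set \<Rightarrow> ('a \<Rightarrow> real) set" where
  "smooth_functions A = {f. \<forall>(U, \<phi>)\<in>A. smooth_on (\<phi> ` U) (f \<circ> inv_into U \<phi>)}"

text \<open>
  Tangent vectors at \<open>x\<close> are the derivations at \<open>x\<close> of the algebra of smooth functions. They are
  represented as total functionals vanishing on functions that are not smooth, so that equality of
  tangent vectors is equality in HOL.
\<close>

type_synonym 'a tvec = "('a \<Rightarrow> real) \<Rightarrow> real"

definition tangent_space ::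
  "('a::topological_space, 'n::finite) chart set \<Rightarrow> 'a \<Rightarrow> 'a tvec set" where
  "tangent_space A x = {v.
     (\<forall>f\<in>smooth_functions A. \<forall>h\<in>smooth_functions A. \<forall>a b.
        v (\<lambda>y. a * f y + b * h y) = a * v f + b * v h) \<and>
     (\<forall>f\<in>smooth_functions A. \<forall>h\<in>smooth_functions A.
        v (\<lambda>y. f y * h y) = f x * v h + h x * v f) \<and>
     (\<forall>f. f \<notin> smooth_functions A \<longrightarrow> v f = 0)}"

definition tv_zero :: "'a tvec" where
  "tv_zero = (\<lambda>f. 0)"

definition tv_comb :: "real \<Rightarrow> 'a tvec \<Rightarrow> real \<Rightarrow> 'a tvec \<Rightarrow> 'a tvec" where
  "tv_comb a v b w = (\<lambda>f. a * v f + b * w f)"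

type_synonym 'a vfield = "'a \<Rightarrow> 'a tvec"

definition deriv_along :: "'a vfield \<Rightarrow> ('a \<Rightarrow> real) \<Rightarrow> 'a \<Rightarrow> real" where
  "deriv_along X f = (\<lambda>x. X x f)"

text \<open>A vector field is smooth iff it maps smooth functions to smooth functions.\<close>

definition vector_fields ::
  "('a::topological_space, 'n::finite) chart set \<Rightarrow> 'a vfield set" where
  "vector_fields A = {X.
     (\<forall>x. X x \<in> tangent_space A x) \<and>
     (\<forall>f\<in>smooth_functions A. deriv_along X f \<in> smooth_functions A)}"

definition vf_comb ::
  "('a \<Rightarrow> real) \<Rightarrow> 'a vfield \<Rightarrow> ('a \<Rightarrow> real) \<Rightarrow> 'a vfield \<Rightarrow> 'a vfield" where
  "vf_comb f X h Y = (\<lambda>x. tv_comb (f x) (X x) (h x) (Y x))"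

definition vf_diff :: "'a vfield \<Rightarrow> 'a vfield \<Rightarrow> 'a vfield" where
  "vf_diff X Y = (\<lambda>x. tv_comb 1 (X x) (- 1) (Y x))"

definition vf_zero :: "'a vfield" where
  "vf_zero = (\<lambda>x. tv_zero)"

definition lie_bracket ::
  "('a::topological_space, 'n::finite) chart set \<Rightarrow> 'a vfield \<Rightarrow> 'a vfield \<Rightarrow> 'a vfield" where
  "lie_bracket A X Y = (\<lambda>x f.
     if f \<in> smooth_functions A then X x (deriv_along Y f) - Y x (deriv_along X f) else 0)"

text \<open>
  Smoothness of tensor fields is expressed through their values on smooth vector fields. The values
  of \<open>J x\<close> and \<open>g x\<close> outside the tangent space at \<open>x\<close> are irrelevant.
\<close>

type_synonym 'a endo_field = "'a \<Rightarrow> 'a tvec \<Rightarrow> 'a tvec"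

definition endo_apply :: "'a endo_field \<Rightarrow> 'a vfield \<Rightarrow> 'a vfield" where
  "endo_apply J X = (\<lambda>x. J x (X x))"

definition tensor_field_1_1 ::
  "('a::topological_space, 'n::finite) chart set \<Rightarrow> 'a endo_field \<Rightarrow> bool" where
  "tensor_field_1_1 A J \<longleftrightarrow>
     (\<forall>x. \<forall>v\<in>tangent_space A x. J x v \<in> tangent_space A x) \<and>
     (\<forall>x. \<forall>v\<in>tangent_space A x. \<forall>w\<in>tangent_space A x. \<forall>a b.
        J x (tv_comb a v b w) = tv_comb a (J x v) b (J x w)) \<and>
     (\<forall>X\<in>vector_fields A. endo_apply J X \<in> vector_fields A)"

definition bundle_isomorphism ::
  "('a::topological_space, 'n::finite) chart set \<Rightarrow> 'a endo_field \<Rightarrow> bool" where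
  "bundle_isomorphism A J \<longleftrightarrow>
     tensor_field_1_1 A J \<and>
     (\<forall>x. bij_betw (J x) (tangent_space A x) (tangent_space A x)) \<and>
     tensor_field_1_1 A (\<lambda>x. inv_into (tangent_space A x) (J x))"

definition metallic_structure ::
  "('a::topological_space, 'n::finite) chart set \<Rightarrow> 'a endo_field \<Rightarrow> bool" where
  "metallic_structure A J \<longleftrightarrow>
     tensor_field_1_1 A J \<and> bundle_isomorphism A J \<and>
     (\<exists>p q :: real. \<forall>x. \<forall>v\<in>tangent_space A x. J x (J x v) = tv_comb p (J x v) q v)"

type_synonym 'a form_field = "'a \<Rightarrow> 'a tvec \<Rightarrow> 'a tvec \<Rightarrow> real"

definition form_apply :: "'a form_field \<Rightarrow> 'a vfield \<Rightarrow> 'a vfield \<Rightarrow> 'a \<Rightarrow> real" where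
  "form_apply g X Y = (\<lambda>x. g x (X x) (Y x))"

definition tensor_field_0_2 ::
  "('a::topological_space, 'n::finite) chart set \<Rightarrow> 'a form_field \<Rightarrow> bool" where
  "tensor_field_0_2 A g \<longleftrightarrow>
     (\<forall>x. \<forall>u\<in>tangent_space A x. \<forall>v\<in>tangent_space A x. \<forall>w\<in>tangent_space A x. \<forall>a b.
        g x (tv_comb a u b v) w = a * g x u w + b * g x v w \<and>
        g x w (tv_comb a u b v) = a * g x w u + b * g x w v) \<and>
     (\<forall>X\<in>vector_fields A. \<forall>Y\<in>vector_fields A. form_apply g X Y \<in> smooth_functions A)"

text \<open>
  The index of \<open>g\<close> is not required to be constant; it is locally constant, hence constant on each
  connected component.
\<close>

definition pseudo_riemannian_metric ::
  "('a::topological_space, 'n::finite) chart set \<Rightarrow> 'a form_field \<Rightarrow> bool" where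
  "pseudo_riemannian_metric A g \<longleftrightarrow>
     tensor_field_0_2 A g \<and>
     (\<forall>x. \<forall>v\<in>tangent_space A x. \<forall>w\<in>tangent_space A x. g x v w = g x w v) \<and>
     (\<forall>x. \<forall>v\<in>tangent_space A x. (\<forall>w\<in>tangent_space A x. g x v w = 0) \<longrightarrow> v = tv_zero)"

definition metallic_pseudo_riemannian_manifold ::
  "('a::{t2_space, second_countable_topology}, 'n::finite) chart set \<Rightarrow>
     'a endo_field \<Rightarrow> 'a form_field \<Rightarrow> bool" where
  "metallic_pseudo_riemannian_manifold A J g \<longleftrightarrow>
     smooth_atlas A \<and> pseudo_riemannian_metric A g \<and> metallic_structure A J \<and>
     (\<forall>X\<in>vector_fields A. \<forall>Y\<in>vector_fields A.
        form_apply g (endo_apply J X) Y = form_apply g X (endo_apply J Y))"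

type_synonym 'a connection = "'a vfield \<Rightarrow> 'a vfield \<Rightarrow> 'a vfield"

definition linear_connection ::
  "('a::topological_space, 'n::finite) chart set \<Rightarrow> 'a connection \<Rightarrow> bool" where
  "linear_connection A D \<longleftrightarrow>
     (\<forall>X\<in>vector_fields A. \<forall>Y\<in>vector_fields A. D X Y \<in> vector_fields A) \<and>
     (\<forall>X\<in>vector_fields A. \<forall>Y\<in>vector_fields A. \<forall>Z\<in>vector_fields A.
        \<forall>f\<in>smooth_functions A. \<forall>h\<in>smooth_functions A.
        D (vf_comb f X h Y) Z = vf_comb f (D X Z) h (D Y Z)) \<and>
     (\<forall>X\<in>vector_fields A. \<forall>Y\<in>vector_fields A. \<forall>Z\<in>vector_fields A. \<forall>a b.
        D X (vf_comb (\<lambda>_. a) Y (\<lambda>_. b) Z) = vf_comb (\<lambda>_. a) (D X Y) (\<lambda>_. b) (D X Z)) \<and>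
     (\<forall>X\<in>vector_fields A. \<forall>Y\<in>vector_fields A. \<forall>f\<in>smooth_functions A.
        D X (\<lambda>x h. f x * Y x h) = vf_comb (deriv_along X f) Y f (D X Y))"

definition torsion_free ::
  "('a::topological_space, 'n::finite) chart set \<Rightarrow> 'a connection \<Rightarrow> bool" where
  "torsion_free A D \<longleftrightarrow>
     (\<forall>X\<in>vector_fields A. \<forall>Y\<in>vector_fields A. vf_diff (D X Y) (D Y X) = lie_bracket A X Y)"

text \<open>\<open>(\<nabla>\<^sub>X J) Y\<close> and \<open>(\<nabla>\<^sub>X g)(Y, Z)\<close>\<close>

definition nabla_endo :: "'a connection \<Rightarrow> 'a endo_field \<Rightarrow> 'a vfield \<Rightarrow> 'a vfield \<Rightarrow> 'a vfield" where
  "nabla_endo D J X Y = vf_diff (D X (endo_apply J Y)) (endo_apply J (D X Y))"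

definition nabla_form ::
  "'a connection \<Rightarrow> 'a form_field \<Rightarrow> 'a vfield \<Rightarrow> 'a vfield \<Rightarrow> 'a vfield \<Rightarrow> 'a \<Rightarrow> real" where
  "nabla_form D g X Y Z = (\<lambda>x.
     deriv_along X (form_apply g Y Z) x - form_apply g (D X Y) Z x - form_apply g Y (D X Z) x)"

definition J_connection ::
  "('a::topological_space, 'n::finite) chart set \<Rightarrow> 'a endo_field \<Rightarrow> 'a connection \<Rightarrow> bool" where
  "J_connection A J D \<longleftrightarrow> linear_connection A D \<and>
     (\<forall>X\<in>vector_fields A. \<forall>Y\<in>vector_fields A. nabla_endo D J X Y = vf_zero)"

definition codazzi_coupled ::
  "('a::topological_space, 'n::finite) chart set \<Rightarrow> 'a connection \<Rightarrow> 'a form_field \<Rightarrow> bool" where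
  "codazzi_coupled A D g \<longleftrightarrow>
     (\<forall>X\<in>vector_fields A. \<forall>Y\<in>vector_fields A. \<forall>Z\<in>vector_fields A.
        nabla_form D g X Y Z = nabla_form D g Z X Y)"

definition levi_civita_connection ::
  "('a::topological_space, 'n::finite) chart set \<Rightarrow> 'a form_field \<Rightarrow> 'a connection \<Rightarrow> bool" where
  "levi_civita_connection A g D \<longleftrightarrow>
     linear_connection A D \<and> torsion_free A D \<and>
     (\<forall>X\<in>vector_fields A. \<forall>Y\<in>vector_fields A. \<forall>Z\<in>vector_fields A.
        nabla_form D g X Y Z = (\<lambda>x. 0))"

text \<open>
  The Levi-Civita connection is unique on smooth vector fields; the existential quantifier only
  absorbs the irrelevant values of \<open>D\<close> elsewhere.
\<close>

definition locally_metallic_pseudo_riemannian_manifold ::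
  "('a::{t2_space, second_countable_topology}, 'n::finite) chart set \<Rightarrow>
     'a endo_field \<Rightarrow> 'a form_field \<Rightarrow> bool" where
  "locally_metallic_pseudo_riemannian_manifold A J g \<longleftrightarrow>
     metallic_pseudo_riemannian_manifold A J g \<and>
     (\<exists>D. levi_civita_connection A g D \<and>
        (\<forall>X\<in>vector_fields A. \<forall>Y\<in>vector_fields A. nabla_endo D J X Y = vf_zero))"

text \<open>\<open>(L\<^sub>X J) Y\<close>\<close>

definition lie_derivative_endo ::
  "('a::topological_space, 'n::finite) chart set \<Rightarrow> 'a endo_field \<Rightarrow> 'a vfield \<Rightarrow> 'a vfield \<Rightarrow> 'a vfield"
  where
  "lie_derivative_endo A J X Y =
     vf_diff (lie_bracket A X (endo_apply J Y)) (endo_apply J (lie_bracket A X Y))"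

definition tachibana ::
  "('a::topological_space, 'n::finite) chart set \<Rightarrow> 'a endo_field \<Rightarrow> 'a form_field \<Rightarrow>
     'a vfield \<Rightarrow> 'a vfield \<Rightarrow> 'a vfield \<Rightarrow> 'a \<Rightarrow> real" where
  "tachibana A J g X Y Z = (\<lambda>x.
     deriv_along (endo_apply J X) (form_apply g Y Z) x
     - deriv_along X (form_apply g (endo_apply J Y) Z) x
     + form_apply g (lie_derivative_endo A J Y X) Z x
     + form_apply g Y (lie_derivative_endo A J Z X) x)"

end

theory Submission
  imports Defs
begin

text \<open>
  The proof is governed by the tensor \<open>C(X, Y, Z) = (\<nabla>\<^sub>X g)(Y, Z)\<close>. It is symmetric in \<open>Y, Z\<close>
  because \<open>g\<close> is, so Codazzi coupling makes it symmetric in all three arguments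
  (\<open>nabla_form_swap\<close>). Since \<open>\<nabla>J = 0\<close> and \<open>J\<close> is \<open>g\<close>-symmetric, \<open>C(X, JY, Z) = C(X, Y, JZ)\<close>
  (\<open>nabla_form_J\<close>), and total symmetry lets \<open>J\<close> wander to the first slot as well
  (\<open>nabla_form_J_first\<close>). Rewriting the brackets in the Tachibana operator through the torsion-free
  \<open>\<nabla>\<close> and using \<open>\<nabla>J = 0\<close> leaves \<open>(\<Phi>\<^sub>J g)(X, Y, Z) = C(JX, Y, Z) - C(X, JY, Z)\<close>, which vanishes.

  For the second claim the Levi-Civita connection is written down explicitly. Let \<open>K(X, Y)\<close> be the
  vector field with \<open>g(K(X, Y), Z) = C(X, Y, Z) / 2\<close>. Then \<open>\<nabla> + K\<close> is torsion-free because \<open>K\<close> is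
  symmetric, and metric because the derivative of \<open>g\<close> changes by \<open>- C / 2 - C / 2\<close>. It is the mean
  of \<open>\<nabla>\<close> and its \<open>g\<close>-dual connection. The relation \<open>C(X, JY, Z) = C(X, Y, JZ)\<close> says that
  \<open>K(X, JY) = J K(X, Y)\<close>, so \<open>J\<close> is parallel for \<open>\<nabla> + K\<close> too.

  What costs work is that \<open>K(X, Y)\<close> exists, that is, that every one-form is represented by a smooth
  vector field (\<open>one_form_representation\<close>). Tangent vectors being abstract derivations, this needs
  local frames, which Hadamard's lemma supplies (\<open>local_frame\<close>); the components of the representing
  field then come from Cramer's rule for the Gram matrix. To stay with globally defined smooth
  functions and fields throughout, coordinates and coordinate fields are multiplied by a cut-off
  function \<open>\<beta>\<close>, and the usual frame identities are stated with the denominators \<open>\<beta>\<close> cleared.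
\<close>

section \<open>Differentiability of finite order on open sets\<close>

text \<open>
  Openness of \<open>S\<close> matters: derivatives are taken in the full space, so agreement on \<open>S\<close> controls
  them only at interior points.
\<close>

lemma Ck_on_cong:
  assumes "open S" "\<And>x. x \<in> S \<Longrightarrow> f x = g x" "Ck_on k S f"
  shows "Ck_on k S g"
  using assms(2,3)
proof (induction k arbitrary: f g)
  case 0
  then show ?case by (metis Ck_on.simps(1) continuous_on_cong)
next
  case (Suc k)
  have D: "(g has_derivative frechet_derivative f (at x)) (at x)" if "x \<in> S" for x
    by (rule has_derivative_transform_within_open[OF _ assms(1) that Suc.prems(1)])
       (use Suc.prems that in \<open>auto simp: frechet_derivative_works\<close>)
  have eq: "frechet_derivative f (at x) v = frechet_derivative g (at x) v" if "x \<in> S" for x v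
    using frechet_derivative_at[OF D[OF that]] by (rule fun_cong)
  have "Ck_on k S (\<lambda>x. frechet_derivative f (at x) v)" for v
    using Suc.prems(2) by simp
  then have "Ck_on k S (\<lambda>x. frechet_derivative g (at x) v)" for v
    by (intro Suc.IH[where f = "\<lambda>x. frechet_derivative f (at x) v" and g = "\<lambda>x. frechet_derivative g (at x) v"] eq)
  then show ?case using D by (auto simp: differentiable_def)
qed

text \<open>
  Lets the derivative be given by an explicit formula \<open>F\<close> instead of \<open>frechet_derivative\<close>.
\<close>

lemma Ck_on_SucI:
  assumes "open S" "\<And>x. x \<in> S \<Longrightarrow> (f has_derivative F x) (at x)"
    and "\<And>v. Ck_on k S (\<lambda>x. F x v)"
  shows "Ck_on (Suc k) S f"
proof -
  have "frechet_derivative f (at x) = F x" if "x \<in> S" for x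
    by (rule frechet_derivative_at[OF assms(2)[OF that], symmetric])
  then have "Ck_on k S (\<lambda>x. frechet_derivative f (at x) v)" for v
    by (intro Ck_on_cong[OF assms(1) _ assms(3)[of v]]) simp
  then show ?thesis using assms(2) by (auto simp: differentiable_def)
qed

lemma Ck_on_Suc_has_derivative:
  "Ck_on (Suc k) S f \<Longrightarrow> x \<in> S \<Longrightarrow> (f has_derivative frechet_derivative f (at x)) (at x)"
  by (simp add: frechet_derivative_works)

lemma Ck_on_SucD: "Ck_on (Suc k) S f \<Longrightarrow> Ck_on k S f"
proof (induction k arbitrary: f)
  case 0
  then show ?case
    by (auto intro!: continuous_at_imp_continuous_on differentiable_imp_continuous_within)
next
  case (Suc k)
  then show ?case by (metis Ck_on.simps(2))
qed

lemma Ck_on_subset: "Ck_on k S f \<Longrightarrow> T \<subseteq> S \<Longrightarrow> Ck_on k T f"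
  by (induction k arbitrary: f) (auto intro: continuous_on_subset)

lemma Ck_on_local:
  assumes "\<And>x. x \<in> S \<Longrightarrow> \<exists>T. open T \<and> x \<in> T \<and> Ck_on k T f"
  shows "Ck_on k S f"
  using assms
proof (induction k arbitrary: f)
  case 0
  then show ?case
    by (metis Ck_on.simps(1) continuous_on_eq_continuous_at continuous_at_imp_continuous_on)
next
  case (Suc k)
  have "Ck_on k S (\<lambda>x. frechet_derivative f (at x) v)" for v
    by (rule Suc.IH) (use Suc.prems in force)
  moreover have "\<forall>x\<in>S. f differentiable (at x)" using Suc.prems by force
  ultimately show ?case by simp
qed

lemma Ck_on_const: "open S \<Longrightarrow> Ck_on k S (\<lambda>x. c)"
  by (induction k arbitrary: c) (auto intro!: Ck_on_SucI[where F = "\<lambda>_ _. 0"])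

lemma Ck_on_linear:
  assumes "open S" "bounded_linear L" "Ck_on k S f"
  shows "Ck_on k S (\<lambda>x. L (f x))"
  using assms(3)
proof (induction k arbitrary: f)
  case 0
  then show ?case
    using bounded_linear.continuous_on[OF assms(2)] by auto
next
  case (Suc k)
  show ?case
    by (rule Ck_on_SucI[OF assms(1), where F = "\<lambda>x v. L (frechet_derivative f (at x) v)"])
       (use Suc in \<open>auto intro!: bounded_linear.has_derivative[OF assms(2)] Ck_on_Suc_has_derivative\<close>)
qed

lemma Ck_on_id: "open S \<Longrightarrow> Ck_on k S (\<lambda>x. x)"
  by (cases k) (auto intro!: Ck_on_SucI[where F = "\<lambda>_ v. v"] Ck_on_const)

lemma Ck_on_add:
  assumes "open S" "Ck_on k S f" "Ck_on k S g"
  shows "Ck_on k S (\<lambda>x. f x + g x)"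
  using assms(2,3)
proof (induction k arbitrary: f g)
  case (Suc k)
  show ?case
    by (rule Ck_on_SucI[OF assms(1), where
          F = "\<lambda>x v. frechet_derivative f (at x) v + frechet_derivative g (at x) v"])
       (use Suc in \<open>auto intro!: has_derivative_add Ck_on_Suc_has_derivative\<close>)
qed (auto intro: continuous_intros)

lemma Ck_on_mult:
  fixes f g :: "'e::real_normed_vector \<Rightarrow> real"
  assumes "open S" "Ck_on k S f" "Ck_on k S g"
  shows "Ck_on k S (\<lambda>x. f x * g x)"
  using assms(2,3)
proof (induction k arbitrary: f g)
  case (Suc k)
  show ?case
  proof (rule Ck_on_SucI[OF assms(1)])
    show "((\<lambda>x. f x * g x) has_derivative
        (\<lambda>v. f x * frechet_derivative g (at x) v + frechet_derivative f (at x) v * g x)) (at x)"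
      if "x \<in> S" for x
      using Suc.prems that by (intro has_derivative_mult Ck_on_Suc_has_derivative)
    show "Ck_on k S (\<lambda>x. f x * frechet_derivative g (at x) v + frechet_derivative f (at x) v * g x)" for v
      by (intro Ck_on_add Suc.IH assms) (use Suc.prems Ck_on_SucD in auto)
  qed
qed (auto intro: continuous_intros)

lemma Ck_on_sum:
  fixes f :: "'i \<Rightarrow> 'e::real_normed_vector \<Rightarrow> 'f::real_normed_vector"
  assumes "open S" "\<And>i. i \<in> I \<Longrightarrow> Ck_on k S (f i)"
  shows "Ck_on k S (\<lambda>x. \<Sum>i\<in>I. f i x)"
  using assms(2) by (induction I rule: infinite_finite_induct)
    (auto intro!: Ck_on_add Ck_on_const assms(1))

lemma Ck_on_inverse:
  fixes f :: "'e::real_normed_vector \<Rightarrow> real"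
  assumes "open S" "Ck_on k S f" "\<And>x. x \<in> S \<Longrightarrow> f x \<noteq> 0"
  shows "Ck_on k S (\<lambda>x. inverse (f x))"
  using assms(2)
proof (induction k)
  case 0
  then show ?case using assms(3) by (auto intro: continuous_intros)
next
  case (Suc k)
  show ?case
  proof (rule Ck_on_SucI[OF assms(1)])
    show "((\<lambda>x. inverse (f x)) has_derivative
        (\<lambda>v. - (inverse (f x) * frechet_derivative f (at x) v * inverse (f x)))) (at x)"
      if "x \<in> S" for x
      using Suc.prems that assms(3) by (intro Deriv.has_derivative_inverse Ck_on_Suc_has_derivative) auto
    have "Ck_on k S (\<lambda>x. inverse (f x))" using Suc Ck_on_SucD by blast
    then have "Ck_on k S (\<lambda>x. inverse (f x) * frechet_derivative f (at x) v * inverse (f x))" for v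
      by (intro Ck_on_mult assms) (use Suc.prems in auto)
    then show "Ck_on k S (\<lambda>x. - (inverse (f x) * frechet_derivative f (at x) v * inverse (f x)))" for v
      by (intro Ck_on_linear[OF assms(1) bounded_linear_minus[OF bounded_linear_ident]])
  qed
qed

text \<open>
  The chain rule gives \<open>f'(g x)(g'(x) v)\<close>, where \<open>x\<close> occurs twice. Expanding \<open>g'(x) v\<close> in the
  standard basis turns this into a finite sum of products \<open>\<langle>g'(x) v, b\<rangle> f'(g x) b\<close>, to which the
  induction hypothesis for directional derivatives of \<open>f\<close> applies.
\<close>

lemma Ck_on_compose:
  fixes f :: "'m::euclidean_space \<Rightarrow> real" and g :: "'e::real_normed_vector \<Rightarrow> 'm"
  assumes "open S" "open T" "g ` S \<subseteq> T" "Ck_on k T f" "Ck_on k S g"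
  shows "Ck_on k S (\<lambda>x. f (g x))"
  using assms(4,5)
proof (induction k arbitrary: f)
  case 0
  then show ?case using assms(3) continuous_on_compose2 by auto
next
  case (Suc k)
  let ?f' = "\<lambda>x. frechet_derivative f (at (g x))"
  let ?g' = "\<lambda>x. frechet_derivative g (at x)"
  have f': "(f has_derivative ?f' x) (at (g x))" if "x \<in> S" for x
    using Suc.prems that assms(3) by (intro Ck_on_Suc_has_derivative) auto
  have sum: "(\<Sum>b\<in>Basis. (?g' x v \<bullet> b) * ?f' x b) = ?f' x (?g' x v)" if "x \<in> S" for x v
  proof -
    have "linear (?f' x)" using f'[OF that] has_derivative_linear by blast
    then have "?f' x (\<Sum>b\<in>Basis. (?g' x v \<bullet> b) *\<^sub>R b) = (\<Sum>b\<in>Basis. (?g' x v \<bullet> b) *\<^sub>R ?f' x b)"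
      by (simp add: linear_sum linear_scale)
    then show ?thesis by (simp add: euclidean_representation)
  qed
  show ?case
  proof (rule Ck_on_SucI[OF assms(1)])
    show "((\<lambda>x. f (g x)) has_derivative (\<lambda>v. ?f' x (?g' x v))) (at x)" if "x \<in> S" for x
      using has_derivative_compose[OF Ck_on_Suc_has_derivative[OF Suc.prems(2) that] f'[OF that]] .
    have "Ck_on k S (\<lambda>x. ?f' x b)" for b
      using Suc.IH[of "\<lambda>y. frechet_derivative f (at y) b"] Suc.prems Ck_on_SucD by auto
    then have *: "Ck_on k S (\<lambda>x. \<Sum>b\<in>Basis. (?g' x v \<bullet> b) * ?f' x b)" for v
      by (intro Ck_on_sum Ck_on_mult assms Ck_on_linear[OF assms(1) bounded_linear_inner_left])
         (use Suc.prems in auto)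
    show "Ck_on k S (\<lambda>x. ?f' x (?g' x v))" for v
      by (rule Ck_on_cong[OF assms(1) sum *[of v]])
  qed
qed


section \<open>Smooth functions on open sets\<close>

lemma smooth_on_cong:
  "open S \<Longrightarrow> (\<And>x. x \<in> S \<Longrightarrow> f x = g x) \<Longrightarrow> smooth_on S f \<Longrightarrow> smooth_on S g"
  unfolding smooth_on_def using Ck_on_cong by blast

lemma smooth_on_subset: "smooth_on S f \<Longrightarrow> T \<subseteq> S \<Longrightarrow> smooth_on T f"
  unfolding smooth_on_def using Ck_on_subset by blast

lemma smooth_on_local:
  assumes "\<And>x. x \<in> S \<Longrightarrow> \<exists>T. open T \<and> x \<in> T \<and> smooth_on T f"
  shows "smooth_on S f"
  unfolding smooth_on_def
proof
  show "Ck_on k S f" for k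
    by (rule Ck_on_local) (use assms in \<open>force simp: smooth_on_def\<close>)
qed

lemma smooth_on_const: "open S \<Longrightarrow> smooth_on S (\<lambda>x. c)"
  by (simp add: smooth_on_def Ck_on_const)

lemma smooth_on_linear:
  "open S \<Longrightarrow> bounded_linear L \<Longrightarrow> smooth_on S f \<Longrightarrow> smooth_on S (\<lambda>x. L (f x))"
  by (simp add: smooth_on_def Ck_on_linear)

lemma smooth_on_id: "open S \<Longrightarrow> smooth_on S (\<lambda>x. x)"
  by (simp add: smooth_on_def Ck_on_id)

lemma smooth_on_add:
  "open S \<Longrightarrow> smooth_on S f \<Longrightarrow> smooth_on S g \<Longrightarrow> smooth_on S (\<lambda>x. f x + g x)"
  by (simp add: smooth_on_def Ck_on_add)

lemma smooth_on_mult: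
  fixes f g :: "'e::real_normed_vector \<Rightarrow> real"
  shows "open S \<Longrightarrow> smooth_on S f \<Longrightarrow> smooth_on S g \<Longrightarrow> smooth_on S (\<lambda>x. f x * g x)"
  by (simp add: smooth_on_def Ck_on_mult)

lemma smooth_on_inverse:
  fixes f :: "'e::real_normed_vector \<Rightarrow> real"
  shows "open S \<Longrightarrow> smooth_on S f \<Longrightarrow> (\<And>x. x \<in> S \<Longrightarrow> f x \<noteq> 0) \<Longrightarrow> smooth_on S (\<lambda>x. inverse (f x))"
  by (simp add: smooth_on_def Ck_on_inverse)

lemma smooth_on_compose:
  fixes f :: "'m::euclidean_space \<Rightarrow> real" and g :: "'e::real_normed_vector \<Rightarrow> 'm"
  shows "open S \<Longrightarrow> open T \<Longrightarrow> g ` S \<subseteq> T \<Longrightarrow> smooth_on T f \<Longrightarrow> smooth_on S g \<Longrightarrow> smooth_on S (\<lambda>x. f (g x))"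
  by (simp add: smooth_on_def Ck_on_compose[of S T])

lemma smooth_on_sum:
  fixes f :: "'i \<Rightarrow> 'e::real_normed_vector \<Rightarrow> 'f::real_normed_vector"
  shows "open S \<Longrightarrow> (\<And>i. i \<in> I \<Longrightarrow> smooth_on S (f i)) \<Longrightarrow> smooth_on S (\<lambda>x. \<Sum>i\<in>I. f i x)"
  by (simp add: smooth_on_def Ck_on_sum)

lemma smooth_on_frechet_derivative:
  "smooth_on S f \<Longrightarrow> smooth_on S (\<lambda>x. frechet_derivative f (at x) v)"
  unfolding smooth_on_def by (metis Ck_on.simps(2))

lemma smooth_on_has_derivative:
  "smooth_on S f \<Longrightarrow> x \<in> S \<Longrightarrow> (f has_derivative frechet_derivative f (at x)) (at x)"
  unfolding smooth_on_def using Ck_on_Suc_has_derivative by blast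


section \<open>Smooth cut-off functions\<close>

text \<open>
  Functions of this shape are closed under differentiation; with \<open>P = 1\<close> this is the classical
  \<open>e\<^bsup>-1/t\<^esup>\<close>, smooth and positive exactly for \<open>t > 0\<close>.
\<close>

definition flat :: "real poly \<Rightarrow> real \<Rightarrow> real" where
  "flat P t = (if t > 0 then poly P (inverse t) * exp (- inverse t) else 0)"

lemma flat_tendsto_0: "(flat P \<longlongrightarrow> 0) (at 0)"
proof -
  have "((\<lambda>s. \<Sum>i\<le>degree P. coeff P i * (s ^ i / exp s)) \<longlongrightarrow> (\<Sum>i\<le>degree P. coeff P i * 0)) at_top"
    by (intro tendsto_intros tendsto_power_div_exp_0)
  then have "((\<lambda>s. poly P s * exp (- s)) \<longlongrightarrow> 0) at_top"
    by (simp add: poly_altdef sum_distrib_right exp_minus divide_inverse mult.assoc)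
  then have "((\<lambda>t. poly P (inverse t) * exp (- inverse t)) \<longlongrightarrow> 0) (at_right 0)"
    by (rule filterlim_compose[OF _ filterlim_inverse_at_top_right])
  then have "(flat P \<longlongrightarrow> 0) (at_right 0)"
    by (rule Lim_transform_eventually) (auto simp: flat_def eventually_at_right_less intro!: eventually_at_rightI[of 0 1])
  moreover have "(flat P \<longlongrightarrow> 0) (at_left 0)"
    by (rule Lim_transform_eventually[OF tendsto_const])
       (auto simp: flat_def intro!: eventually_at_leftI[of "-1"])
  ultimately show ?thesis by (simp add: filterlim_split_at)
qed

text \<open>
  With \<open>s = 1/t\<close>, the derivative of \<open>P(s) e\<^bsup>-s\<^esup>\<close> in \<open>t\<close> is \<open>s\<^sup>2 (P(s) - P'(s)) e\<^bsup>-s\<^esup>\<close>. At \<open>t = 0\<close>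
  the difference quotient is again of the form \<open>flat Q\<close>, with \<open>Q(s) = s P(s)\<close>, hence tends to \<open>0\<close>.
\<close>

lemma flat_has_derivative:
  "(flat P has_real_derivative flat ([:0,0,1:] * (P - pderiv P)) t) (at t)"
proof -
  consider "t > 0" | "t < 0" | "t = 0" by linarith
  then show ?thesis
  proof cases
    case 1
    have "((\<lambda>t. poly P (inverse t) * exp (- inverse t)) has_real_derivative
        flat ([:0,0,1:] * (P - pderiv P)) t) (at t)"
      using 1 by (auto intro!: derivative_eq_intros poly_DERIV DERIV_chain2[of "poly P"]
        simp: flat_def field_simps power2_eq_square)
    then show ?thesis
      by (rule has_field_derivative_transform_within_open[OF _ open_greaterThan[of 0]])
         (use 1 in \<open>auto simp: flat_def\<close>)
  next
    case 2
    have "((\<lambda>t. 0) has_real_derivative 0) (at t)" by simp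
    then have "(flat P has_real_derivative 0) (at t)"
      by (rule has_field_derivative_transform_within_open[OF _ open_lessThan[of 0]])
         (use 2 in \<open>auto simp: flat_def\<close>)
    then show ?thesis using 2 by (simp add: flat_def)
  next
    case 3
    have "((\<lambda>h. (flat P (0 + h) - flat P 0) / h) \<longlongrightarrow> 0) (at 0)"
      by (rule Lim_transform_eventually[OF flat_tendsto_0[of "[:0,1:] * P"]])
         (auto simp: flat_def eventually_at_filter field_simps)
    then show ?thesis using 3 by (simp add: DERIV_def flat_def)
  qed
qed

lemma Ck_on_flat: "Ck_on k UNIV (flat P)"
proof (induction k arbitrary: P)
  case 0
  then show ?case
    using DERIV_isCont[OF flat_has_derivative] by (simp add: continuous_at_imp_continuous_on)
next
  case (Suc k)
  show ?case
    by (rule Ck_on_SucI[where F = "\<lambda>t v. flat ([:0,0,1:] * (P - pderiv P)) t * v"])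
       (use flat_has_derivative Suc.IH in
         \<open>auto simp: has_field_derivative_def intro!: Ck_on_linear[OF open_UNIV bounded_linear_mult_left]\<close>)
qed

text \<open>
  Positivity near \<open>p\<close> is what the frames below ask of a cut-off function: in their identities the
  powers of the cut-off function are cleared like denominators.
\<close>

definition bump :: "'e::euclidean_space \<Rightarrow> real \<Rightarrow> 'e \<Rightarrow> real" where
  "bump p r u = flat 1 (r\<^sup>2 - (u - p) \<bullet> (u - p))"

lemma smooth_on_bump:
  assumes "open S" shows "smooth_on S (bump p r)"
proof -
  have 1: "smooth_on UNIV (\<lambda>u::'a. (u - p) \<bullet> b)" for b
    using smooth_on_add[OF open_UNIV smooth_on_linear[OF open_UNIV bounded_linear_inner_left smooth_on_id[OF open_UNIV]]
      smooth_on_const[OF open_UNIV], of b "- (p \<bullet> b)"] by (simp add: inner_diff_left)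
  have "smooth_on UNIV (\<lambda>u::'a. r\<^sup>2 + (-1) * (\<Sum>b\<in>Basis. ((u - p) \<bullet> b) * ((u - p) \<bullet> b)))"
    by (intro smooth_on_add smooth_on_mult smooth_on_const smooth_on_sum 1 open_UNIV)
  then have 2: "smooth_on UNIV (\<lambda>u. r\<^sup>2 - (u - p) \<bullet> (u - p))"
    by (simp add: euclidean_inner[of "_ - _" "_ - _"])
  have "smooth_on UNIV (bump p r)"
    unfolding bump_def using smooth_on_compose[OF open_UNIV open_UNIV _ _ 2, of "flat 1"] Ck_on_flat
    by (simp add: smooth_on_def)
  then show ?thesis by (rule smooth_on_subset) simp
qed

lemma bump_eq_0_iff: "r > 0 \<Longrightarrow> bump p r u = 0 \<longleftrightarrow> dist p u \<ge> r"
  unfolding bump_def flat_def power2_norm_eq_inner[symmetric]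
  using power2_less_imp_less[of "norm (u - p)" r] power_strict_mono[of "norm (u - p)" r 2]
  by (auto simp: dist_norm norm_minus_commute[of p] not_less)

section \<open>Hadamard's lemma\<close>

lemma ray_in_convex:
  fixes p u :: "'e::real_normed_vector"
  assumes "convex S" "p \<in> S" "u \<in> S" "t \<in> cbox 0 (1::real)"
  shows "p + t *\<^sub>R (u - p) \<in> S"
proof -
  have "(1 - t) *\<^sub>R p + t *\<^sub>R u \<in> S"
    using assms by (intro convexD_alt) auto
  then show ?thesis by (simp add: algebra_simps)
qed

text \<open>
  Differentiation under the integral sign. The inner derivative of \<open>u \<mapsto> p + t (u - p)\<close> contributes a
  factor \<open>t\<close>, so the derivative is an integral of the same kind with \<open>m\<close> raised by one; the weight
  \<open>t\<^sup>m\<close> is there to make the induction below close.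
\<close>

lemma ray_average_has_derivative:
  fixes F :: "'e::euclidean_space \<Rightarrow> real"
  assumes S: "open S" "convex S" "p \<in> S" and F: "Ck_on (Suc 0) S F" and u: "u \<in> S"
  shows "((\<lambda>u. integral (cbox 0 1) (\<lambda>t. t ^ m * F (p + t *\<^sub>R (u - p)))) has_derivative
    (\<lambda>v. integral (cbox 0 1) (\<lambda>t. t ^ Suc m * frechet_derivative F (at (p + t *\<^sub>R (u - p))) v))) (at u)"
proof -
  define F' where "F' x = Blinfun (frechet_derivative F (at x))" for x
  have der: "(F has_derivative frechet_derivative F (at x)) (at x)" if "x \<in> S" for x
    using Ck_on_Suc_has_derivative[OF F that] .
  have F'_apply: "blinfun_apply (F' x) = frechet_derivative F (at x)" if "x \<in> S" for x
    unfolding F'_def using der[OF that] has_derivative_bounded_linear bounded_linear_Blinfun_apply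
    by blast
  have ray: "p + t *\<^sub>R (x - p) \<in> S" if "x \<in> S" "t \<in> cbox 0 1" for x and t :: real
    using ray_in_convex[OF S(2,3) that] .
  have contF': "continuous_on S F'"
    by (rule continuous_on_blinfun_componentwise)
       (use F F'_apply in \<open>auto cong: continuous_on_cong\<close>)
  have contF: "continuous_on S F" using F Ck_on_SucD[of 0] by simp
  have cont_ray: "continuous_on (S \<times> cbox 0 1) (\<lambda>(x, t::real). t ^ Suc m *\<^sub>R F' (p + t *\<^sub>R (x - p)))"
    unfolding case_prod_beta
    by (intro continuous_on_scaleR continuous_on_power continuous_on_snd continuous_on_id
          continuous_on_compose2[OF contF'])
       (auto intro!: continuous_intros ray)
  have cont1: "continuous_on (cbox 0 1) (\<lambda>t::real. t ^ Suc m *\<^sub>R F' (p + t *\<^sub>R (u - p)))"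
    by (intro continuous_on_scaleR continuous_on_power continuous_on_id continuous_on_compose2[OF contF'])
       (auto intro!: continuous_intros ray[OF u])
  have der_int: "((\<lambda>u. integral (cbox 0 1) (\<lambda>t. t ^ m * F (p + t *\<^sub>R (u - p)))) has_derivative
      blinfun_apply (integral (cbox 0 1) (\<lambda>t. t ^ Suc m *\<^sub>R F' (p + t *\<^sub>R (u - p))))) (at u within S)"
  proof (rule leibniz_rule[OF _ _ cont_ray u S(2)])
    fix x and t :: real assume xt: "x \<in> S" "t \<in> cbox 0 1"
    have "((\<lambda>x. p + t *\<^sub>R (x - p)) has_derivative (\<lambda>v. t *\<^sub>R v)) (at x)"
      by (auto intro!: derivative_eq_intros)
    from has_derivative_compose[OF this der[OF ray[OF xt]]]
    have "((\<lambda>x. F (p + t *\<^sub>R (x - p))) has_derivative (\<lambda>v. F' (p + t *\<^sub>R (x - p)) (t *\<^sub>R v))) (at x)"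
      by (simp add: F'_apply[OF ray[OF xt]])
    then have "((\<lambda>x. t ^ m * F (p + t *\<^sub>R (x - p))) has_derivative
        (\<lambda>v. t ^ m * F' (p + t *\<^sub>R (x - p)) (t *\<^sub>R v))) (at x)"
      by (rule has_derivative_mult_right)
    moreover have "(\<lambda>v. t ^ m * F' (p + t *\<^sub>R (x - p)) (t *\<^sub>R v)) =
        blinfun_apply (t ^ Suc m *\<^sub>R F' (p + t *\<^sub>R (x - p)))"
      by (rule ext) (simp add: blinfun.scaleR_left blinfun.scaleR_right)
    ultimately show "((\<lambda>x. t ^ m * F (p + t *\<^sub>R (x - p))) has_derivative
        blinfun_apply (t ^ Suc m *\<^sub>R F' (p + t *\<^sub>R (x - p)))) (at x within S)"
      by (metis has_derivative_at_withinI)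
  next
    fix x assume x: "x \<in> S"
    have "continuous_on (cbox 0 1) (\<lambda>t. F (p + t *\<^sub>R (x - p)))"
      by (rule continuous_on_compose2[OF contF]) (auto intro!: continuous_intros ray[OF x])
    then show "(\<lambda>t. t ^ m * F (p + t *\<^sub>R (x - p))) integrable_on cbox 0 1"
      by (intro integrable_continuous continuous_on_mult continuous_on_power continuous_on_id)
  qed
  have "blinfun_apply (integral (cbox 0 1) (\<lambda>t. t ^ Suc m *\<^sub>R F' (p + t *\<^sub>R (u - p)))) v =
      integral (cbox 0 1) (\<lambda>t. t ^ Suc m * frechet_derivative F (at (p + t *\<^sub>R (u - p))) v)" for v
  proof -
    have "blinfun_apply (integral (cbox 0 1) (\<lambda>t. t ^ Suc m *\<^sub>R F' (p + t *\<^sub>R (u - p)))) v =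
        integral (cbox 0 1) (\<lambda>t. blinfun_apply (t ^ Suc m *\<^sub>R F' (p + t *\<^sub>R (u - p))) v)"
      by (rule blinfun_apply_integral[OF integrable_continuous[OF cont1]])
    also have "\<dots> = integral (cbox 0 1) (\<lambda>t. t ^ Suc m * frechet_derivative F (at (p + t *\<^sub>R (u - p))) v)"
      by (rule integral_cong) (simp add: blinfun.scaleR_left F'_apply ray u)
    finally show ?thesis .
  qed
  then show ?thesis
    using der_int unfolding at_within_open[OF u S(1)] by (auto intro: has_derivative_eq_rhs)
qed

lemma Ck_on_ray_average:
  fixes F :: "'e::euclidean_space \<Rightarrow> real"
  assumes S: "open S" "convex S" "p \<in> S" and F: "smooth_on S F"
  shows "Ck_on k S (\<lambda>u. integral (cbox 0 1) (\<lambda>t. t ^ m * F (p + t *\<^sub>R (u - p))))"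
  using F
proof (induction k arbitrary: F m)
  case 0
  have "Ck_on (Suc 0) S F" using 0 by (auto simp: smooth_on_def)
  from ray_average_has_derivative[OF S this] show ?case
    unfolding Ck_on.simps
    by (intro continuous_at_imp_continuous_on ballI has_derivative_continuous)
next
  case (Suc k)
  have "Ck_on (Suc 0) S F" using Suc.prems unfolding smooth_on_def by blast
  note der = ray_average_has_derivative[OF S this]
  show ?case
    by (rule Ck_on_SucI[OF S(1) der Suc.IH[OF smooth_on_frechet_derivative[OF Suc.prems]]])
qed

text \<open>
  Integrate the derivative of \<open>F\<close> along the segment from \<open>p\<close> to \<open>u\<close>. The functions \<open>G i\<close> are the
  averages of the partial derivatives of \<open>F\<close> over that segment.
\<close>

lemma hadamard:
  fixes F :: "real ^ 'n::finite \<Rightarrow> real"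
  assumes S: "open S" "convex S" "p \<in> S" and F: "smooth_on S F"
  obtains G where "\<And>i. smooth_on S (G i)"
    "\<And>i. G i p = frechet_derivative F (at p) (axis i 1)"
    "\<And>u. u \<in> S \<Longrightarrow> F u = F p + (\<Sum>i\<in>UNIV. (u $ i - p $ i) * G i u)"
proof
  define G where "G i u = integral (cbox 0 1)
      (\<lambda>t. t ^ 0 * frechet_derivative F (at (p + t *\<^sub>R (u - p))) (axis i 1))" for i u
  show "smooth_on S (G i)" for i
    unfolding G_def smooth_on_def
    using Ck_on_ray_average[OF S smooth_on_frechet_derivative[OF F]] by blast
  show "G i p = frechet_derivative F (at p) (axis i 1)" for i
    by (simp add: G_def)
  fix u assume u: "u \<in> S"
  have ray: "p + t *\<^sub>R (u - p) \<in> S" if "t \<in> cbox 0 1" for t :: real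
    using ray_in_convex[OF S(2,3) u that] .
  let ?F' = "\<lambda>t. frechet_derivative F (at (p + t *\<^sub>R (u - p)))"
  have expand: "?F' t (u - p) = (\<Sum>i\<in>UNIV. (u $ i - p $ i) * ?F' t (axis i 1))" if "t \<in> cbox 0 1" for t
  proof -
    have "linear (?F' t)"
      using smooth_on_has_derivative[OF F ray[OF that]] has_derivative_linear by blast
    then have "?F' t (\<Sum>i\<in>UNIV. (u - p) $ i *s axis i 1) = (\<Sum>i\<in>UNIV. (u - p) $ i * ?F' t (axis i 1))"
      by (simp add: linear_sum linear_scale scalar_mult_eq_scaleR)
    then show ?thesis using basis_expansion[of "u - p"] by simp
  qed
  have "continuous_on S (\<lambda>x. frechet_derivative F (at x) v)" for v
    using smooth_on_frechet_derivative[OF F] unfolding smooth_on_def by (metis Ck_on.simps(1))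
  then have cont: "continuous_on (cbox 0 1) (\<lambda>t. ?F' t (axis i 1))" for i
    by (rule continuous_on_compose2) (use ray in \<open>auto intro!: continuous_intros\<close>)
  have "((\<lambda>t. ?F' t (u - p)) has_integral F (p + 1 *\<^sub>R (u - p)) - F (p + 0 *\<^sub>R (u - p))) {0..1}"
  proof (rule fundamental_theorem_of_calculus)
    fix t :: real assume t: "t \<in> {0..1}"
    have "((\<lambda>t. p + t *\<^sub>R (u - p)) has_derivative (\<lambda>h. h *\<^sub>R (u - p))) (at t)"
      by (auto intro!: derivative_eq_intros)
    from has_derivative_compose[OF this smooth_on_has_derivative[OF F ray]] t
    have "((\<lambda>t. F (p + t *\<^sub>R (u - p))) has_derivative (\<lambda>h. ?F' t (h *\<^sub>R (u - p)))) (at t)" by simp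
    moreover have "?F' t (h *\<^sub>R (u - p)) = h *\<^sub>R ?F' t (u - p)" for h
      using smooth_on_has_derivative[OF F ray] has_derivative_linear linear_scale t by (metis cbox_interval)
    ultimately show "((\<lambda>t. F (p + t *\<^sub>R (u - p))) has_vector_derivative ?F' t (u - p)) (at t within {0..1})"
      unfolding has_vector_derivative_def by (simp add: has_derivative_at_withinI)
  qed simp
  then have "F u - F p = integral (cbox 0 1) (\<lambda>t. ?F' t (u - p))"
    by (simp add: integral_unique)
  also have "\<dots> = integral (cbox 0 1) (\<lambda>t. \<Sum>i\<in>UNIV. (u $ i - p $ i) * ?F' t (axis i 1))"
    by (rule integral_cong) (rule expand)
  also have "\<dots> = (\<Sum>i\<in>UNIV. integral (cbox 0 1) (\<lambda>t. (u $ i - p $ i) * ?F' t (axis i 1)))"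
    by (intro integral_sum integrable_continuous continuous_intros cont) simp
  also have "\<dots> = (\<Sum>i\<in>UNIV. (u $ i - p $ i) * G i u)"
    by (simp add: G_def)
  finally show "F u = F p + (\<Sum>i\<in>UNIV. (u $ i - p $ i) * G i u)" by simp
qed


section \<open>Derivations and local frames on a manifold\<close>

text \<open>
  Tangent vectors are functionals on all functions, normalised to vanish on the non-smooth ones;
  equalities between them therefore have to be checked there as well.
\<close>

lemma tangent_space_zero_outside: "v \<in> tangent_space A x \<Longrightarrow> f \<notin> smooth_functions A \<Longrightarrow> v f = 0"
  by (simp add: tangent_space_def)

lemma derivation_lin:
  "v \<in> tangent_space A x \<Longrightarrow> f \<in> smooth_functions A \<Longrightarrow> h \<in> smooth_functions A \<Longrightarrow>
    v (\<lambda>y. a * f y + b * h y) = a * v f + b * v h"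
  by (simp add: tangent_space_def)

lemma derivation_mult:
  "v \<in> tangent_space A x \<Longrightarrow> f \<in> smooth_functions A \<Longrightarrow> h \<in> smooth_functions A \<Longrightarrow>
    v (\<lambda>y. f y * h y) = f x * v h + h x * v f"
  by (simp add: tangent_space_def)

lemma smooth_functionsI:
  "(\<And>U \<phi>. (U, \<phi>) \<in> A \<Longrightarrow> smooth_on (\<phi> ` U) (\<lambda>u. f (inv_into U \<phi> u))) \<Longrightarrow> f \<in> smooth_functions A"
  by (auto simp: smooth_functions_def o_def)

lemma smooth_functionsD:
  "f \<in> smooth_functions A \<Longrightarrow> (U, \<phi>) \<in> A \<Longrightarrow> smooth_on (\<phi> ` U) (\<lambda>u. f (inv_into U \<phi> u))"
  by (auto simp: smooth_functions_def o_def)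

text \<open>
  The function \<open>G\<close> of the coordinates \<open>\<phi>\<close>, cut off and extended by zero to the whole manifold. The
  cut-off has half the radius of the ball on which \<open>G\<close> is used, so that its support is compact
  inside the chart.
\<close>

definition cutoff_pullback ::
  "'a set \<Rightarrow> ('a \<Rightarrow> real ^ 'n::finite) \<Rightarrow> real ^ 'n \<Rightarrow> real \<Rightarrow> (real ^ 'n \<Rightarrow> real) \<Rightarrow> 'a \<Rightarrow> real" where
  "cutoff_pullback U \<phi> p R G x =
     (if x \<in> U \<and> \<phi> x \<in> ball p R then bump p (R / 2) (\<phi> x) * G (\<phi> x) else 0)"

locale smooth_manifold =
  fixes A :: "('a::{t2_space, second_countable_topology}, 'n::finite) chart set"
  assumes smooth_atlas: "smooth_atlas A"
begin

abbreviation "C\<^sub>M \<equiv> smooth_functions A"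

lemma chart:
  assumes "(U, \<phi>) \<in> A"
  shows chart_open: "open U" and chart_open_image: "open (\<phi> ` U)" and chart_inj: "inj_on \<phi> U"
    and chart_homeo: "homeomorphism U (\<phi> ` U) \<phi> (inv_into U \<phi>)"
  using smooth_atlas assms by (auto simp: smooth_atlas_def is_chart_def)

lemma chart_covers: "\<exists>U \<phi>. (U, \<phi>) \<in> A \<and> x \<in> U"
  using smooth_atlas by (force simp: smooth_atlas_def)

lemma chart_transition:
  "(U, \<phi>) \<in> A \<Longrightarrow> (V, \<psi>) \<in> A \<Longrightarrow> smooth_on (\<phi> ` (U \<inter> V)) (\<lambda>u. \<psi> (inv_into U \<phi> u))"
  using smooth_atlas unfolding smooth_atlas_def o_def by fast

lemma chart_image_open:
  assumes "(U, \<phi>) \<in> A" "open W" "W \<subseteq> U"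
  shows "open (\<phi> ` W)"
proof -
  have "openin (top_of_set (\<phi> ` U)) (\<phi> ` W)"
    by (rule homeomorphism_imp_open_map[OF chart_homeo[OF assms(1)]])
       (use assms in \<open>auto simp: openin_open_eq chart_open\<close>)
  then show ?thesis using chart_open_image[OF assms(1)] by (simp add: openin_open_eq)
qed

lemma smooth_fun_lin: "f \<in> C\<^sub>M \<Longrightarrow> h \<in> C\<^sub>M \<Longrightarrow> (\<lambda>x. a * f x + b * h x) \<in> C\<^sub>M"
  by (rule smooth_functionsI)
     (intro smooth_on_add smooth_on_mult smooth_on_const chart_open_image smooth_functionsD)

lemma smooth_fun_mult: "f \<in> C\<^sub>M \<Longrightarrow> h \<in> C\<^sub>M \<Longrightarrow> (\<lambda>x. f x * h x) \<in> C\<^sub>M"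
  by (rule smooth_functionsI)
     (intro smooth_on_mult chart_open_image smooth_functionsD)

lemma smooth_fun_const: "(\<lambda>x. c) \<in> C\<^sub>M"
  by (rule smooth_functionsI) (intro smooth_on_const chart_open_image)

lemma smooth_fun_add: "f \<in> C\<^sub>M \<Longrightarrow> h \<in> C\<^sub>M \<Longrightarrow> (\<lambda>x. f x + h x) \<in> C\<^sub>M"
  using smooth_fun_lin[of f h 1 1] by simp

lemma smooth_fun_diff: "f \<in> C\<^sub>M \<Longrightarrow> h \<in> C\<^sub>M \<Longrightarrow> (\<lambda>x. f x - h x) \<in> C\<^sub>M"
  using smooth_fun_lin[of f h 1 "-1"] by simp

lemma smooth_fun_sum: "(\<And>i. i \<in> I \<Longrightarrow> f i \<in> C\<^sub>M) \<Longrightarrow> (\<lambda>x. \<Sum>i\<in>I. f i x) \<in> C\<^sub>M"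
  by (induction I rule: infinite_finite_induct) (auto intro: smooth_fun_const smooth_fun_add)

lemma smooth_fun_prod: "(\<And>i. i \<in> I \<Longrightarrow> f i \<in> C\<^sub>M) \<Longrightarrow> (\<lambda>x. \<Prod>i\<in>I. f i x) \<in> C\<^sub>M"
  by (induction I rule: infinite_finite_induct) (auto intro: smooth_fun_const smooth_fun_mult)

text \<open>
  Cramer's rule and cleared denominators produce functions known only up to smooth factors that are
  nonzero near a given point; this recovers their smoothness.
\<close>

lemma smooth_fun_locally_quotient:
  assumes "\<And>x\<^sub>0. \<exists>d\<in>C\<^sub>M. \<exists>l\<in>C\<^sub>M. d x\<^sub>0 \<noteq> 0 \<and> (\<forall>x. d x \<noteq> 0 \<longrightarrow> k x = l x / d x)"
  shows "k \<in> C\<^sub>M"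
proof (rule smooth_functionsI, rule smooth_on_local)
  fix U \<phi> u assume c: "(U, \<phi>) \<in> A" and u: "u \<in> \<phi> ` U"
  obtain d l where dl: "d \<in> C\<^sub>M" "l \<in> C\<^sub>M" "d (inv_into U \<phi> u) \<noteq> 0"
    "\<And>x. d x \<noteq> 0 \<Longrightarrow> k x = l x / d x"
    using assms by metis
  let ?d = "\<lambda>u. d (inv_into U \<phi> u)" and ?l = "\<lambda>u. l (inv_into U \<phi> u)"
  let ?T = "\<phi> ` U \<inter> ?d -` (- {0})"
  have sd: "smooth_on (\<phi> ` U) ?d" and sl: "smooth_on (\<phi> ` U) ?l"
    using dl c by (auto intro: smooth_functionsD)
  have "continuous_on (\<phi> ` U) ?d" using sd unfolding smooth_on_def by (metis Ck_on.simps(1))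
  then have T: "open ?T"
    by (intro continuous_open_preimage chart_open_image[OF c]) auto
  have "smooth_on ?T (\<lambda>u. ?l u * inverse (?d u))"
    by (intro smooth_on_mult smooth_on_inverse T smooth_on_subset[OF sd] smooth_on_subset[OF sl]) auto
  then have "smooth_on ?T (\<lambda>u. k (inv_into U \<phi> u))"
    by (rule smooth_on_cong[OF T, rotated]) (auto simp: dl(4) divide_inverse)
  then show "\<exists>T. open T \<and> u \<in> T \<and> smooth_on T (\<lambda>u. k (inv_into U \<phi> u))"
    using T u dl(3) by (intro exI[of _ ?T]) auto
qed

text \<open>
  Inside the chart the function is a smooth function of the coordinates. Everywhere else it
  vanishes on a neighbourhood, because its support lies in the preimage of a closed ball, which is
  compact and hence closed in the Hausdorff space \<open>'a\<close>.
\<close>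

lemma cutoff_pullback_smooth:
  assumes c: "(U, \<phi>) \<in> A" and R: "R > 0" "ball p R \<subseteq> \<phi> ` U" and G: "smooth_on (ball p R) G"
  shows "cutoff_pullback U \<phi> p R G \<in> C\<^sub>M"
proof (rule smooth_functionsI, rule smooth_on_local)
  fix V \<psi> q assume d: "(V, \<psi>) \<in> A" and q: "q \<in> \<psi> ` V"
  let ?f = "\<lambda>u. cutoff_pullback U \<phi> p R G (inv_into V \<psi> u)"
  let ?N = "U \<inter> \<phi> -` ball p R"
  have "continuous_on U \<phi>" using chart_homeo[OF c] by (simp add: homeomorphism_def)
  then have N: "open ?N"
    by (intro continuous_open_preimage chart_open[OF c]) auto
  obtain y where y: "y \<in> V" "q = \<psi> y" using q by auto
  have inv: "inv_into V \<psi> (\<psi> z) = z" if "z \<in> V" for z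
    using that chart_inj[OF d] by simp
  show "\<exists>T. open T \<and> q \<in> T \<and> smooth_on T ?f"
  proof (cases "y \<in> ?N")
    case True
    let ?T = "\<psi> ` (V \<inter> ?N)"
    have T: "open ?T" by (intro chart_image_open[OF d] open_Int N chart_open[OF d]) auto
    have "smooth_on ?T (\<lambda>u. bump p (R / 2) (\<phi> (inv_into V \<psi> u)) * G (\<phi> (inv_into V \<psi> u)))"
      by (rule smooth_on_compose[OF T open_ball[of p R], where f = "\<lambda>u. bump p (R / 2) u * G u"])
         (auto simp: inv intro!: smooth_on_mult smooth_on_bump G smooth_on_subset[OF chart_transition[OF d c]])
    then have "smooth_on ?T ?f"
      by (rule smooth_on_cong[OF T, rotated]) (auto simp: inv cutoff_pullback_def)
    then show ?thesis using T y True by (intro exI[of _ ?T]) auto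
  next
    case False
    \<comment> \<open>\<open>?K\<close> contains the support of the function and misses \<open>y\<close>.\<close>
    let ?K = "inv_into U \<phi> ` cball p (R / 2)"
    have sub: "cball p (R / 2) \<subseteq> ball p R" using R(1) by auto
    have "continuous_on (cball p (R / 2)) (inv_into U \<phi>)"
      using chart_homeo[OF c] sub R(2) by (meson homeomorphism_cont2 continuous_on_subset)
    then have "closed ?K" by (intro compact_imp_closed compact_continuous_image) auto
    then have T: "open (\<psi> ` (V - ?K))"
      by (intro chart_image_open[OF d] open_Diff chart_open[OF d]) auto
    have zero: "cutoff_pullback U \<phi> p R G z = 0" if "z \<notin> ?K" for z
    proof (rule ccontr)
      assume "cutoff_pullback U \<phi> p R G z \<noteq> 0"
      then have "z \<in> U" "bump p (R / 2) (\<phi> z) \<noteq> 0" by (auto simp: cutoff_pullback_def split: if_splits)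
      then have "\<phi> z \<in> cball p (R / 2)" "z = inv_into U \<phi> (\<phi> z)"
        using bump_eq_0_iff[of "R / 2" p "\<phi> z"] R(1) chart_inj[OF c] by auto
      then show False using that by blast
    qed
    have "smooth_on (\<psi> ` (V - ?K)) ?f"
      by (rule smooth_on_cong[OF T _ smooth_on_const[OF T, of 0]]) (use zero in \<open>auto simp: inv\<close>)
    moreover have "y \<notin> ?K"
    proof
      assume "y \<in> ?K"
      then obtain u where u: "u \<in> cball p (R / 2)" "y = inv_into U \<phi> u" by auto
      then have "u \<in> \<phi> ` U" using sub R(2) by blast
      then have "y \<in> U" "\<phi> y = u" using u by (auto simp: inv_into_into f_inv_into_f)
      then show False using False u sub by auto
    qed
    ultimately show ?thesis using T y by (intro exI[of _ "\<psi> ` (V - ?K)"]) auto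
  qed
qed

lemma derivation_add:
  "v \<in> tangent_space A x \<Longrightarrow> f \<in> C\<^sub>M \<Longrightarrow> h \<in> C\<^sub>M \<Longrightarrow> v (\<lambda>y. f y + h y) = v f + v h"
  using derivation_lin[of v A x f h 1 1] by simp

lemma derivation_cmult:
  "v \<in> tangent_space A x \<Longrightarrow> f \<in> C\<^sub>M \<Longrightarrow> v (\<lambda>y. a * f y) = a * v f"
  using derivation_lin[of v A x f f a 0] by simp

lemma derivation_zero: "v \<in> tangent_space A x \<Longrightarrow> v (\<lambda>y. 0) = 0"
  using derivation_cmult[of v x "\<lambda>y. 0" 0] smooth_fun_const by simp

lemma derivation_sum:
  assumes "v \<in> tangent_space A x" "\<And>i. i \<in> I \<Longrightarrow> f i \<in> C\<^sub>M"
  shows "v (\<lambda>y. \<Sum>i\<in>I. f i y) = (\<Sum>i\<in>I. v (f i))"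
  using assms(2)
proof (induction I rule: infinite_finite_induct)
  case (insert i I)
  then show ?case
    using derivation_add[OF assms(1), of "f i" "\<lambda>y. \<Sum>i\<in>I. f i y"] smooth_fun_sum[of I f] by auto
qed (auto intro: derivation_zero[OF assms(1)])

text \<open>
  The coordinate field \<open>\<partial>/\<partial>\<phi>\<^sub>i\<close>, multiplied by the cut-off so that it is defined everywhere.
\<close>

definition coord_field :: "'a set \<Rightarrow> ('a \<Rightarrow> real ^ 'n) \<Rightarrow> real ^ 'n \<Rightarrow> real \<Rightarrow> 'n \<Rightarrow> 'a vfield" where
  "coord_field U \<phi> p R i x f = (if f \<in> C\<^sub>M then
     cutoff_pullback U \<phi> p R (\<lambda>u. frechet_derivative (\<lambda>u. f (inv_into U \<phi> u)) (at u) (axis i 1)) x else 0)"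

lemma chart_has_derivative:
  assumes "(U, \<phi>) \<in> A" "u \<in> \<phi> ` U" "f \<in> C\<^sub>M"
  shows "((\<lambda>u. f (inv_into U \<phi> u)) has_derivative frechet_derivative (\<lambda>u. f (inv_into U \<phi> u)) (at u)) (at u)"
  by (rule smooth_on_has_derivative[OF smooth_functionsD[OF assms(3,1)] assms(2)])

lemma coord_field_vector_field:
  assumes c: "(U, \<phi>) \<in> A" and R: "R > 0" "ball p R \<subseteq> \<phi> ` U"
  shows "coord_field U \<phi> p R i \<in> vector_fields A"
proof -
  let ?F = "\<lambda>f u. f (inv_into U \<phi> u)" and ?e = "axis i 1"
  have lin: "frechet_derivative (?F (\<lambda>y. a * f y + b * h y)) (at u) ?e =
      a * frechet_derivative (?F f) (at u) ?e + b * frechet_derivative (?F h) (at u) ?e"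
    if "f \<in> C\<^sub>M" "h \<in> C\<^sub>M" "u \<in> \<phi> ` U" for f h a b u
  proof -
    have "(?F (\<lambda>y. a * f y + b * h y) has_derivative
        (\<lambda>v. a * frechet_derivative (?F f) (at u) v + b * frechet_derivative (?F h) (at u) v)) (at u)"
      by (intro has_derivative_add has_derivative_mult_right chart_has_derivative c that)
    from fun_cong[OF frechet_derivative_at[OF this]] show ?thesis by (rule sym)
  qed
  have mult: "frechet_derivative (?F (\<lambda>y. f y * h y)) (at u) ?e =
      ?F f u * frechet_derivative (?F h) (at u) ?e + frechet_derivative (?F f) (at u) ?e * ?F h u"
    if "f \<in> C\<^sub>M" "h \<in> C\<^sub>M" "u \<in> \<phi> ` U" for f h u
  proof -
    have "(?F (\<lambda>y. f y * h y) has_derivative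
        (\<lambda>v. ?F f u * frechet_derivative (?F h) (at u) v + frechet_derivative (?F f) (at u) v * ?F h u)) (at u)"
      by (intro has_derivative_mult chart_has_derivative c that)
    from fun_cong[OF frechet_derivative_at[OF this]] show ?thesis by (rule sym)
  qed
  have inv: "inv_into U \<phi> (\<phi> x) = x" if "x \<in> U" for x
    using that chart_inj[OF c] by simp
  have "coord_field U \<phi> p R i x \<in> tangent_space A x" for x
    unfolding tangent_space_def
    by (auto simp: coord_field_def cutoff_pullback_def smooth_fun_lin smooth_fun_mult lin mult inv algebra_simps)
  moreover have "deriv_along (coord_field U \<phi> p R i) f \<in> C\<^sub>M" if "f \<in> C\<^sub>M" for f
    using cutoff_pullback_smooth[OF c R smooth_on_frechet_derivative[OF
          smooth_on_subset[OF smooth_functionsD[OF that c] R(2)]], of ?e]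
    by (simp add: deriv_along_def coord_field_def that)
  ultimately show ?thesis by (simp add: vector_fields_def)
qed

text \<open>
  Think of \<open>y i = \<beta> \<phi>\<^sub>i\<close> and \<open>E i = \<beta> \<partial>/\<partial>\<phi>\<^sub>i\<close> for local coordinates \<open>\<phi>\<^sub>i\<close>. The form
  \<open>\<theta>\<^sub>i(v) = \<beta> v(y\<^sub>i) - y\<^sub>i v(\<beta>)\<close> is then \<open>\<beta>\<^sup>2 d\<phi>\<^sub>i\<close>, so the two identities are
  \<open>v = \<Sum>\<^sub>i d\<phi>\<^sub>i(v) \<partial>/\<partial>\<phi>\<^sub>i\<close> and \<open>d\<phi>\<^sub>j(\<partial>/\<partial>\<phi>\<^sub>i) = \<delta>\<^sub>i\<^sub>j\<close>, each multiplied by \<open>\<beta>\<^sup>3\<close>. In this form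
  they hold on the whole manifold, trivially so where \<open>\<beta>\<close> vanishes.
\<close>

definition scaled_frame :: "('a \<Rightarrow> real) \<Rightarrow> ('n \<Rightarrow> 'a \<Rightarrow> real) \<Rightarrow> ('n \<Rightarrow> 'a vfield) \<Rightarrow> bool" where
  "scaled_frame \<beta> y E \<longleftrightarrow>
     \<beta> \<in> C\<^sub>M \<and> (\<forall>i. y i \<in> C\<^sub>M) \<and> (\<forall>i. E i \<in> vector_fields A) \<and>
     (\<forall>x. \<forall>v\<in>tangent_space A x. \<forall>f.
        \<beta> x ^ 3 * v f = (\<Sum>i\<in>UNIV. (\<beta> x * v (y i) - y i x * v \<beta>) * E i x f)) \<and>
     (\<forall>x i j. \<beta> x * E i x (y j) - y j x * E i x \<beta> = (if i = j then \<beta> x ^ 3 else 0))"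

lemma scaled_frameD:
  assumes "scaled_frame \<beta> y E"
  shows "\<beta> \<in> C\<^sub>M" "y i \<in> C\<^sub>M" "E i \<in> vector_fields A"
    "v \<in> tangent_space A x \<Longrightarrow>
       \<beta> x ^ 3 * v f = (\<Sum>i\<in>UNIV. (\<beta> x * v (y i) - y i x * v \<beta>) * E i x f)"
    "\<beta> x * E i x (y j) - y j x * E i x \<beta> = (if i = j then \<beta> x ^ 3 else 0)"
  using assms unfolding scaled_frame_def by blast+

text \<open>
  At a point \<open>x\<close> of the chart, Hadamard's lemma writes a smooth \<open>f\<close> as \<open>f x + \<Sum>\<^sub>i (\<phi>\<^sub>i - \<phi>\<^sub>i x) G\<^sub>i\<close> near
  \<open>x\<close>. Multiplied by \<open>\<beta>\<^sup>2\<close> this becomes an identity between globally defined smooth functions, to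
  which the derivation \<open>v\<close> can be applied; the factors \<open>\<phi>\<^sub>i - \<phi>\<^sub>i x\<close> vanish at \<open>x\<close>, so only
  \<open>G\<^sub>i x\<close>, the partial derivatives of \<open>f\<close>, survive.
\<close>

lemma local_frame: "\<exists>\<beta> y E. scaled_frame \<beta> y E \<and> \<beta> x\<^sub>0 \<noteq> 0"
proof -
  obtain U \<phi> where c: "(U, \<phi>) \<in> A" "x\<^sub>0 \<in> U" using chart_covers by blast
  define p where "p = \<phi> x\<^sub>0"
  obtain R where R: "R > 0" "ball p R \<subseteq> \<phi> ` U"
    using chart_open_image[OF c(1)] c(2) unfolding p_def open_contains_ball by blast
  let ?b = "bump p (R / 2)" and ?cut = "cutoff_pullback U \<phi> p R"
  define \<beta> where "\<beta> = ?cut (\<lambda>u. 1)"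
  define y where "y i = ?cut (\<lambda>u. u $ i)" for i
  define E where "E = coord_field U \<phi> p R"
  have inv: "inv_into U \<phi> (\<phi> x) = x" if "x \<in> U" for x
    using that chart_inj[OF c(1)] by simp
  have inv_mem: "inv_into U \<phi> u \<in> U" "\<phi> (inv_into U \<phi> u) = u" if "u \<in> ball p R" for u
    using that R(2) by (auto simp: inv_into_into f_inv_into_f subset_iff)
  have \<beta>: "\<beta> \<in> C\<^sub>M"
    unfolding \<beta>_def by (intro cutoff_pullback_smooth c R smooth_on_const open_ball)
  have y: "y i \<in> C\<^sub>M" for i
    unfolding y_def
    by (intro cutoff_pullback_smooth c R smooth_on_linear[where L = "\<lambda>u. u $ i"]
        bounded_linear_vec_nth smooth_on_id open_ball)
  have E: "E i \<in> vector_fields A" for i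
    unfolding E_def by (rule coord_field_vector_field[OF c(1) R])
  have \<beta>0: "\<beta> x\<^sub>0 \<noteq> 0"
    using c R by (simp add: \<beta>_def cutoff_pullback_def p_def bump_eq_0_iff)
  have span: "\<beta> x ^ 3 * v f = (\<Sum>i\<in>UNIV. (\<beta> x * v (y i) - y i x * v \<beta>) * E i x f)"
    if v: "v \<in> tangent_space A x" for x v f
  proof (cases "f \<in> C\<^sub>M \<and> x \<in> U \<and> \<phi> x \<in> ball p R")
    case False
    then have "E i x f = 0" for i by (auto simp: E_def coord_field_def cutoff_pullback_def)
    moreover have "\<beta> x * v f = 0"
      using False tangent_space_zero_outside[OF v] by (auto simp: \<beta>_def cutoff_pullback_def)
    ultimately show ?thesis by (auto simp: power3_eq_cube)
  next
    case True
    then have f: "f \<in> C\<^sub>M" and x: "x \<in> U" "\<phi> x \<in> ball p R" by auto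
    obtain G where G: "\<And>i. smooth_on (ball p R) (G i)"
      "\<And>i. G i (\<phi> x) = frechet_derivative (\<lambda>u. f (inv_into U \<phi> u)) (at (\<phi> x)) (axis i 1)"
      "\<And>u. u \<in> ball p R \<Longrightarrow> f (inv_into U \<phi> u) =
         f (inv_into U \<phi> (\<phi> x)) + (\<Sum>i\<in>UNIV. (u $ i - \<phi> x $ i) * G i u)"
      by (rule hadamard[OF open_ball convex_ball x(2) smooth_on_subset[OF smooth_functionsD[OF f c(1)] R(2)]])
         (rule that)
    define h where "h i = ?cut (G i)" for i
    \<comment> \<open>The cut-off of \<open>\<phi>\<^sub>i - \<phi>\<^sub>i x\<close>, in the linear-combination format of \<open>derivation_lin\<close>.\<close>
    define w where "w i z = 1 * y i z + (- (\<phi> x $ i)) * \<beta> z" for i z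
    have h: "h i \<in> C\<^sub>M" for i
      unfolding h_def by (intro cutoff_pullback_smooth c R G)
    have w: "w i \<in> C\<^sub>M" for i
      unfolding w_def by (rule smooth_fun_lin[OF y \<beta>])
    have vw: "v (w i) = v (y i) - \<phi> x $ i * v \<beta>" for i
      unfolding w_def using derivation_lin[OF v y \<beta>, of 1 i "- (\<phi> x $ i)"] by simp
    have hx: "h i x = E i x f" for i
      using x f by (simp add: h_def E_def coord_field_def cutoff_pullback_def G(2))
    have yx: "y i x = \<phi> x $ i * \<beta> x" for i
      using x by (simp add: y_def \<beta>_def cutoff_pullback_def)
    have \<beta>2: "(\<lambda>z. \<beta> z * \<beta> z) \<in> C\<^sub>M" by (rule smooth_fun_mult[OF \<beta> \<beta>])
    have wh: "(\<lambda>z. w i z * h i z) \<in> C\<^sub>M" for i by (rule smooth_fun_mult[OF w h])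
    have vwh: "v (\<lambda>z. w i z * h i z) = E i x f * (v (y i) - \<phi> x $ i * v \<beta>)" for i
      using derivation_mult[OF v w h] by (simp add: hx vw) (simp add: w_def yx)
    \<comment> \<open>One factor \<open>\<beta>\<close> cuts off \<open>\<phi>\<^sub>i - \<phi>\<^sub>i x\<close> to the smooth function \<open>w i\<close>, the other one cuts off
      \<open>G i\<close> to \<open>h i\<close>.\<close>
    have "(\<beta> z * \<beta> z) * f z = f x * (\<beta> z * \<beta> z) + (\<Sum>i\<in>UNIV. w i z * h i z)" for z
    proof (cases "z \<in> U \<and> \<phi> z \<in> ball p R")
      case True
      then have "f z = f x + (\<Sum>i\<in>UNIV. (\<phi> z $ i - \<phi> x $ i) * G i (\<phi> z))"
        using G(3)[of "\<phi> z"] by (simp add: inv x)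
      then show ?thesis
        using True
        by (simp only: w_def h_def y_def \<beta>_def cutoff_pullback_def simp_thms if_True)
           (simp add: sum_distrib_left algebra_simps)
    next
      case False
      then show ?thesis by (auto simp: w_def h_def y_def \<beta>_def cutoff_pullback_def)
    qed
    then have "v (\<lambda>z. (\<beta> z * \<beta> z) * f z) = v (\<lambda>z. f x * (\<beta> z * \<beta> z) + (\<Sum>i\<in>UNIV. w i z * h i z))"
      by simp
    also have "\<dots> = f x * v (\<lambda>z. \<beta> z * \<beta> z) + (\<Sum>i\<in>UNIV. v (\<lambda>z. w i z * h i z))"
      using derivation_add[OF v smooth_fun_mult[OF smooth_fun_const \<beta>2] smooth_fun_sum[OF wh]]
      by (simp add: derivation_cmult[OF v \<beta>2] derivation_sum[OF v wh])
    also have "\<dots> = f x * v (\<lambda>z. \<beta> z * \<beta> z) + (\<Sum>i\<in>UNIV. E i x f * (v (y i) - \<phi> x $ i * v \<beta>))"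
      by (simp add: vwh)
    finally have "\<beta> x * \<beta> x * v f = (\<Sum>i\<in>UNIV. E i x f * (v (y i) - \<phi> x $ i * v \<beta>))"
      using derivation_mult[OF v \<beta>2 f] by simp
    then have "\<beta> x * (\<beta> x * \<beta> x * v f) = (\<Sum>i\<in>UNIV. \<beta> x * (E i x f * (v (y i) - \<phi> x $ i * v \<beta>)))"
      by (simp add: sum_distrib_left)
    then show ?thesis
      by (simp add: yx power3_eq_cube algebra_simps)
  qed
  have dual: "\<beta> x * E i x (y j) - y j x * E i x \<beta> = (if i = j then \<beta> x ^ 3 else 0)" for x i j
  proof (cases "x \<in> U \<and> \<phi> x \<in> ball p R")
    case False
    then show ?thesis by (auto simp: \<beta>_def y_def cutoff_pullback_def)
  next
    case True
    let ?D = "frechet_derivative ?b (at (\<phi> x))"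
    have b: "(?b has_derivative ?D) (at (\<phi> x))"
      by (rule smooth_on_has_derivative[OF smooth_on_bump[OF open_UNIV]]) simp
    have pull: "?b u * 1 = \<beta> (inv_into U \<phi> u)" "?b u * u $ j = y j (inv_into U \<phi> u)"
      if "u \<in> ball p R" for u
      using inv_mem[OF that] that by (auto simp: \<beta>_def y_def cutoff_pullback_def)
    have "((\<lambda>u. ?b u * 1) has_derivative (\<lambda>v. ?D v * 1)) (at (\<phi> x))"
      by (intro has_derivative_mult_left b)
    from has_derivative_transform_within_open[OF this open_ball _ pull(1), of p R] True
    have 1: "((\<lambda>u. \<beta> (inv_into U \<phi> u)) has_derivative (\<lambda>v. ?D v * 1)) (at (\<phi> x))" by simp
    have "((\<lambda>u. ?b u * u $ j) has_derivative (\<lambda>v. ?b (\<phi> x) * v $ j + ?D v * \<phi> x $ j)) (at (\<phi> x))"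
      by (intro has_derivative_mult b bounded_linear_imp_has_derivative bounded_linear_vec_nth)
    from has_derivative_transform_within_open[OF this open_ball _ pull(2), of p R] True
    have 2: "((\<lambda>u. y j (inv_into U \<phi> u)) has_derivative (\<lambda>v. ?b (\<phi> x) * v $ j + ?D v * \<phi> x $ j)) (at (\<phi> x))"
      by simp
    show ?thesis
      using True \<beta> y
      by (simp add: E_def coord_field_def cutoff_pullback_def frechet_derivative_at[OF 1, symmetric]
          frechet_derivative_at[OF 2, symmetric])
         (simp add: \<beta>_def y_def cutoff_pullback_def axis_def power3_eq_cube algebra_simps)
  qed
  have "scaled_frame \<beta> y E"
    unfolding scaled_frame_def using \<beta> y E span dual by simp
  then show ?thesis using \<beta>0 by blast
qed

end

section \<open>Vector fields and one-forms\<close>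

context smooth_manifold
begin

abbreviation "\<XX> \<equiv> vector_fields A"
abbreviation "T \<equiv> tangent_space A"

lemma vf_tangent: "X \<in> \<XX> \<Longrightarrow> X x \<in> T x"
  by (simp add: vector_fields_def)

lemma vf_deriv_smooth: "X \<in> \<XX> \<Longrightarrow> f \<in> C\<^sub>M \<Longrightarrow> (\<lambda>x. X x f) \<in> C\<^sub>M"
  by (simp add: vector_fields_def deriv_along_def)

lemma tv_comb_tangent: "v \<in> T x \<Longrightarrow> w \<in> T x \<Longrightarrow> tv_comb a v b w \<in> T x"
  unfolding tangent_space_def tv_comb_def by (auto simp: algebra_simps)

lemma tv_zero_tangent: "tv_zero \<in> T x"
  by (simp add: tangent_space_def tv_zero_def)

lemma tv_sum_tangent: "(\<And>i. i \<in> I \<Longrightarrow> e i \<in> T x) \<Longrightarrow> (\<lambda>f. \<Sum>i\<in>I. c i * e i f) \<in> T x"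
proof (induction I rule: infinite_finite_induct)
  case (insert i I)
  then show ?case
    using tv_comb_tangent[of "e i" x "\<lambda>f. \<Sum>i\<in>I. c i * e i f" "c i" 1] by (simp add: tv_comb_def)
qed (use tv_zero_tangent[unfolded tv_zero_def] in auto)

lemma vector_fieldI:
  "(\<And>x. X x \<in> T x) \<Longrightarrow> (\<And>f. f \<in> C\<^sub>M \<Longrightarrow> (\<lambda>x. X x f) \<in> C\<^sub>M) \<Longrightarrow> X \<in> \<XX>"
  by (simp add: vector_fields_def deriv_along_def)

lemma vf_comb_vector_field:
  assumes "f \<in> C\<^sub>M" "h \<in> C\<^sub>M" "X \<in> \<XX>" "Y \<in> \<XX>"
  shows "vf_comb f X h Y \<in> \<XX>"
  unfolding vf_comb_def
proof (rule vector_fieldI)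
  show "tv_comb (f x) (X x) (h x) (Y x) \<in> T x" for x
    by (intro tv_comb_tangent vf_tangent[OF assms(3)] vf_tangent[OF assms(4)])
  show "(\<lambda>x. tv_comb (f x) (X x) (h x) (Y x) k) \<in> C\<^sub>M" if "k \<in> C\<^sub>M" for k
    unfolding tv_comb_def
    by (intro smooth_fun_add smooth_fun_mult assms vf_deriv_smooth[OF assms(3) that]
        vf_deriv_smooth[OF assms(4) that])
qed

lemma vf_sum_vector_field:
  assumes "\<And>i. i \<in> I \<Longrightarrow> c i \<in> C\<^sub>M" "\<And>i. i \<in> I \<Longrightarrow> E i \<in> \<XX>"
  shows "(\<lambda>x f. \<Sum>i\<in>I. c i x * E i x f) \<in> \<XX>"
proof (rule vector_fieldI)
  show "(\<lambda>f. \<Sum>i\<in>I. c i x * E i x f) \<in> T x" for x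
    by (rule tv_sum_tangent) (rule vf_tangent[OF assms(2)])
  show "(\<lambda>x. \<Sum>i\<in>I. c i x * E i x f) \<in> C\<^sub>M" if "f \<in> C\<^sub>M" for f
    by (intro smooth_fun_sum smooth_fun_mult vf_deriv_smooth[OF assms(2) that]) (rule assms(1))
qed

text \<open>
  Extend the components with respect to a local frame as constants.
\<close>

lemma tangent_vector_extends:
  assumes v: "v \<in> T x" obtains V where "V \<in> \<XX>" "V x = v"
proof -
  obtain \<beta> y E where fr: "scaled_frame \<beta> y E" and \<beta>: "\<beta> x \<noteq> 0"
    using local_frame by blast
  define c where "c i = (\<beta> x * v (y i) - y i x * v \<beta>) / \<beta> x ^ 3" for i
  define V where "V = (\<lambda>z f. \<Sum>i\<in>UNIV. c i * E i z f)"
  have "V \<in> \<XX>" unfolding V_def by (rule vf_sum_vector_field) (auto intro: smooth_fun_const scaled_frameD[OF fr])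
  moreover have "V x = v"
  proof
    fix f
    show "V x f = v f"
      using scaled_frameD(4)[OF fr v, of f] \<beta>
      by (simp add: V_def c_def field_simps flip: sum_divide_distrib)
  qed
  ultimately show ?thesis using that by blast
qed

lemma smooth_fun_det:
  fixes M :: "'a \<Rightarrow> real ^ 'm ^ 'm"
  assumes "\<And>i j. (\<lambda>x. M x $ i $ j) \<in> C\<^sub>M"
  shows "(\<lambda>x. det (M x)) \<in> C\<^sub>M"
  unfolding det_def by (intro smooth_fun_sum smooth_fun_mult smooth_fun_const smooth_fun_prod assms)

text \<open>
  One-forms as maps on vector fields that are linear over smooth functions. That their value at a
  point depends on the argument at that point only follows from this linearity; it is implicit in
  \<open>local_representative\<close>.
\<close>

definition one_form :: "('a vfield \<Rightarrow> 'a \<Rightarrow> real) \<Rightarrow> bool" where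
  "one_form \<omega> \<longleftrightarrow> (\<forall>Z\<in>\<XX>. \<omega> Z \<in> C\<^sub>M) \<and>
     (\<forall>Z\<in>\<XX>. \<forall>W\<in>\<XX>. \<forall>f\<in>C\<^sub>M. \<forall>h\<in>C\<^sub>M. \<omega> (vf_comb f Z h W) = (\<lambda>x. f x * \<omega> Z x + h x * \<omega> W x))"

lemma one_form_sum:
  assumes \<omega>: "one_form \<omega>" and "finite I"
    and "\<And>i. i \<in> I \<Longrightarrow> c i \<in> C\<^sub>M" "\<And>i. i \<in> I \<Longrightarrow> E i \<in> \<XX>"
  shows "\<omega> (\<lambda>x f. \<Sum>i\<in>I. c i x * E i x f) = (\<lambda>x. \<Sum>i\<in>I. c i x * \<omega> (E i) x)"
  using assms(2-)
proof (induction I rule: finite_induct)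
  case empty
  have Z: "(\<lambda>x f. 0) \<in> \<XX>" using vf_sum_vector_field[of "{}"] by simp
  have "\<omega> (vf_comb (\<lambda>x. 0) (\<lambda>x f. 0) (\<lambda>x. 0) (\<lambda>x f. 0)) = (\<lambda>x. 0)"
    using \<omega> Z smooth_fun_const[of 0] by (simp add: one_form_def)
  then show ?case by (simp add: vf_comb_def tv_comb_def)
next
  case (insert i I)
  let ?S = "\<lambda>x f. \<Sum>i\<in>I. c i x * E i x f"
  have "?S \<in> \<XX>" using insert.prems by (intro vf_sum_vector_field) auto
  then have "\<omega> (vf_comb (c i) (E i) (\<lambda>x. 1) ?S) = (\<lambda>x. c i x * \<omega> (E i) x + 1 * \<omega> ?S x)"
    using \<omega> insert.prems smooth_fun_const[of 1] by (simp add: one_form_def)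
  moreover have "vf_comb (c i) (E i) (\<lambda>x. 1) ?S = (\<lambda>x f. \<Sum>i\<in>insert i I. c i x * E i x f)"
    using insert.hyps by (simp add: vf_comb_def tv_comb_def)
  ultimately show ?case using insert by simp
qed

end


section \<open>Representing one-forms by vector fields\<close>

locale pseudo_riemannian_manifold = smooth_manifold A
  for A :: "('a::{t2_space, second_countable_topology}, 'n::finite) chart set" +
  fixes g :: "'a form_field"
  assumes metric: "pseudo_riemannian_metric A g"
begin

lemma g_comb_left:
  "u \<in> T x \<Longrightarrow> v \<in> T x \<Longrightarrow> w \<in> T x \<Longrightarrow> g x (tv_comb a u b v) w = a * g x u w + b * g x v w"
  and g_comb_right:
  "u \<in> T x \<Longrightarrow> v \<in> T x \<Longrightarrow> w \<in> T x \<Longrightarrow> g x w (tv_comb a u b v) = a * g x w u + b * g x w v"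
  using metric by (auto simp: pseudo_riemannian_metric_def tensor_field_0_2_def)

lemma g_sym: "v \<in> T x \<Longrightarrow> w \<in> T x \<Longrightarrow> g x v w = g x w v"
  using metric by (auto simp: pseudo_riemannian_metric_def)

lemma g_smooth: "X \<in> \<XX> \<Longrightarrow> Y \<in> \<XX> \<Longrightarrow> (\<lambda>x. g x (X x) (Y x)) \<in> C\<^sub>M"
  using metric by (auto simp: pseudo_riemannian_metric_def tensor_field_0_2_def form_apply_def)

lemma g_nondegenerate: "v \<in> T x \<Longrightarrow> (\<And>w. w \<in> T x \<Longrightarrow> g x v w = 0) \<Longrightarrow> v = tv_zero"
  using metric by (auto simp: pseudo_riemannian_metric_def)

lemma g_sum_right:
  assumes "w \<in> T x" "finite I" "\<And>i. i \<in> I \<Longrightarrow> e i \<in> T x"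
  shows "g x w (\<lambda>f. \<Sum>i\<in>I. c i * e i f) = (\<Sum>i\<in>I. c i * g x w (e i))"
  using assms(2,3)
proof (induction I rule: finite_induct)
  case empty
  have "tv_comb 0 w 0 w = (\<lambda>f. 0)" by (simp add: tv_comb_def)
  then show ?case using g_comb_right[OF assms(1,1,1), of 0 0] by simp
next
  case (insert i I)
  let ?S = "\<lambda>f. \<Sum>i\<in>I. c i * e i f"
  have "?S \<in> T x" using insert.prems by (intro tv_sum_tangent) auto
  then have "g x w (tv_comb (c i) (e i) 1 ?S) = c i * g x w (e i) + 1 * g x w ?S"
    using insert.prems assms(1) by (intro g_comb_right) auto
  moreover have "tv_comb (c i) (e i) 1 ?S = (\<lambda>f. \<Sum>i\<in>insert i I. c i * e i f)"
    using insert.hyps by (simp add: tv_comb_def)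
  ultimately show ?case using insert by simp
qed

text \<open>
  Nondegeneracy tested on smooth fields instead of tangent vectors. Every uniqueness argument below,
  hence every algebraic property of the tensors defined through \<open>g\<close>, rests on it.
\<close>

lemma g_separates:
  assumes "u \<in> T x" "v \<in> T x" "\<And>Z. Z \<in> \<XX> \<Longrightarrow> g x u (Z x) = g x v (Z x)"
  shows "u = v"
proof -
  have "tv_comb 1 u (-1) v = tv_zero"
  proof (rule g_nondegenerate)
    fix w assume w: "w \<in> T x"
    obtain W where "W \<in> \<XX>" "W x = w" using tangent_vector_extends[OF w] .
    then show "g x (tv_comb 1 u (-1) v) w = 0"
      using assms w g_comb_left[OF assms(1,2) w, of 1 "-1"] by auto
  qed (intro tv_comb_tangent assms)
  then show ?thesis by (auto simp: tv_comb_def tv_zero_def fun_eq_iff)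
qed

lemma vf_eqI:
  assumes "X \<in> \<XX>" "Y \<in> \<XX>" "\<And>Z x. Z \<in> \<XX> \<Longrightarrow> g x (X x) (Z x) = g x (Y x) (Z x)"
  shows "X = Y"
  by (rule ext, rule g_separates) (use assms vf_tangent in auto)

text \<open>
  A kernel vector of the Gram matrix gives a combination of frame fields orthogonal to all frame
  fields, hence to the whole tangent space. By nondegeneracy it is zero, and by duality so are its
  coefficients.
\<close>

lemma gram_matrix_nonsingular:
  assumes fr: "scaled_frame \<beta> y E" and \<beta>: "\<beta> x \<noteq> 0"
  shows "det (\<chi> i j. g x (E i x) (E j x)) \<noteq> 0"
proof -
  let ?G = "\<chi> i j. g x (E i x) (E j x)"
  have Ex: "E i x \<in> T x" for i by (rule vf_tangent[OF scaled_frameD(3)[OF fr]])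
  have "u = 0" if u: "?G *v u = 0" for u
  proof -
    define v where "v = (\<lambda>f. \<Sum>i\<in>UNIV. u $ i * E i x f)"
    have v: "v \<in> T x" unfolding v_def by (rule tv_sum_tangent) (rule Ex)
    have vE: "g x v (E j x) = 0" for j
    proof -
      have "g x v (E j x) = g x (E j x) v" by (rule g_sym[OF v Ex])
      also have "\<dots> = (\<Sum>i\<in>UNIV. u $ i * g x (E j x) (E i x))"
        unfolding v_def by (rule g_sum_right[OF Ex]) (auto intro: Ex)
      also have "\<dots> = (?G *v u) $ j" by (simp add: matrix_vector_mult_def mult.commute)
      finally show ?thesis using u by simp
    qed
    have "v = tv_zero"
    proof (rule g_nondegenerate[OF v])
      fix w assume w: "w \<in> T x"
      let ?\<theta> = "\<lambda>i. \<beta> x * w (y i) - y i x * w \<beta>"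
      have "tv_comb (\<beta> x ^ 3) w 0 w = (\<lambda>f. \<Sum>i\<in>UNIV. ?\<theta> i * E i x f)"
        using scaled_frameD(4)[OF fr w] by (simp add: tv_comb_def)
      then have "\<beta> x ^ 3 * g x v w = g x v (\<lambda>f. \<Sum>i\<in>UNIV. ?\<theta> i * E i x f)"
        using g_comb_right[OF w w v, of "\<beta> x ^ 3" 0] by simp
      also have "\<dots> = 0"
        by (subst g_sum_right[OF v]) (auto simp: vE intro: Ex)
      finally show "g x v w = 0" using \<beta> by simp
    qed
    then have v0: "v f = 0" for f by (simp add: tv_zero_def)
    have "u $ j * \<beta> x ^ 3 = 0" for j
    proof -
      have "u $ j * \<beta> x ^ 3 = (\<Sum>i\<in>UNIV. u $ i * (if i = j then \<beta> x ^ 3 else 0))"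
        by (simp add: if_distrib cong: if_cong)
      also have "\<dots> = (\<Sum>i\<in>UNIV. u $ i * (\<beta> x * E i x (y j) - y j x * E i x \<beta>))"
        by (simp only: scaled_frameD(5)[OF fr])
      also have "\<dots> = \<beta> x * v (y j) - y j x * v \<beta>"
        by (simp add: v_def sum_distrib_left sum_subtractf algebra_simps)
      finally show ?thesis using v0 by simp
    qed
    then show ?thesis using \<beta> by (simp add: vec_eq_iff)
  qed
  then have "\<exists>B. B ** ?G = mat 1" by (simp add: matrix_left_invertible_ker)
  then show ?thesis using invertible_det_nz invertible_left_inverse by blast
qed

text \<open>
  Near a point, the representing field is \<open>\<Sum>\<^sub>k c\<^sub>k E\<^sub>k\<close> where \<open>c\<close> solves the linear system given by the
  Gram matrix and the values \<open>\<omega>(E\<^sub>i)\<close>. Cramer's rule expresses \<open>c\<close> as smooth functions divided by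
  the determinant; clearing that denominator gives a field \<open>L\<close> on the whole manifold representing
  \<open>d \<omega>\<close> instead of \<open>\<omega>\<close>.
\<close>

lemma local_representative:
  assumes \<omega>: "one_form \<omega>"
  obtains d L where "d \<in> C\<^sub>M" "L \<in> \<XX>" "d x\<^sub>0 \<noteq> 0"
    "\<And>x Z. d x \<noteq> 0 \<Longrightarrow> Z \<in> \<XX> \<Longrightarrow> g x (L x) (Z x) = d x * \<omega> Z x"
proof -
  obtain \<beta> y E where fr: "scaled_frame \<beta> y E" and \<beta>0: "\<beta> x\<^sub>0 \<noteq> 0"
    using local_frame by blast
  note \<beta> = scaled_frameD(1)[OF fr] and y = scaled_frameD(2)[OF fr] and E = scaled_frameD(3)[OF fr]
  define G where "G x = (\<chi> i j. g x (E i x) (E j x))" for x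
  \<comment> \<open>The extra factor \<open>\<beta>\<close> here and in \<open>d\<close> makes \<open>d x \<noteq> 0\<close> imply that the frame spans at \<open>x\<close>.\<close>
  define c where "c k x = \<beta> x * det (\<chi> i j. if j = k then \<omega> (E i) x else G x $ i $ j)" for k x
  define L where "L = (\<lambda>x f. \<Sum>k\<in>UNIV. c k x * E k x f)"
  define d where "d x = \<beta> x * det (G x)" for x
  have Ex: "E i x \<in> T x" for i x by (rule vf_tangent[OF E])
  have \<omega>E: "\<omega> (E i) \<in> C\<^sub>M" for i using \<omega> E by (auto simp: one_form_def)
  have G: "(\<lambda>x. G x $ i $ j) \<in> C\<^sub>M" for i j
    unfolding G_def using g_smooth[OF E E] by simp
  have c: "c k \<in> C\<^sub>M" for k
    unfolding c_def[abs_def]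
  proof (intro smooth_fun_mult \<beta> smooth_fun_det)
    show "(\<lambda>x. (\<chi> i j. if j = k then \<omega> (E i) x else G x $ i $ j) $ i $ j) \<in> C\<^sub>M" for i j
      by (cases "j = k") (auto simp: \<omega>E G)
  qed
  then have L: "L \<in> \<XX>"
    unfolding L_def by (intro vf_sum_vector_field c E)
  have d: "d \<in> C\<^sub>M"
    unfolding d_def[abs_def] by (intro smooth_fun_mult \<beta> smooth_fun_det G)
  have d0: "d x\<^sub>0 \<noteq> 0"
    using gram_matrix_nonsingular[OF fr \<beta>0] \<beta>0 by (simp add: d_def G_def)
  have "g x (L x) (Z x) = d x * \<omega> Z x" if dx: "d x \<noteq> 0" and Z: "Z \<in> \<XX>" for x Z
  proof -
    have \<beta>x: "\<beta> x \<noteq> 0" and D: "det (G x) \<noteq> 0" using dx by (auto simp: d_def)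
    have Lx: "L x \<in> T x" by (rule vf_tangent[OF L])
    have LE: "g x (L x) (E j x) = d x * \<omega> (E j) x" for j
    proof -
      have "g x (L x) (E j x) = g x (E j x) (L x)" by (rule g_sym[OF Lx Ex])
      also have "\<dots> = (\<Sum>k\<in>UNIV. c k x * g x (E j x) (E k x))"
        unfolding L_def by (rule g_sum_right[OF Ex]) (auto intro: Ex)
      also have "\<dots> = (G x *v (\<chi> k. c k x)) $ j" 
        by (simp add: matrix_vector_mult_def G_def mult.commute)
      also have "(\<chi> k. c k x) = d x *\<^sub>R (\<chi> k. det (\<chi> i j. if j = k then (\<chi> i. \<omega> (E i) x) $ i else G x $ i $ j) / det (G x))"
        using D by (simp add: vec_eq_iff c_def d_def cong: if_cong)
      also have "G x *v \<dots> = d x *\<^sub>R (G x *v (\<chi> k. det (\<chi> i j. if j = k then (\<chi> i. \<omega> (E i) x) $ i else G x $ i $ j) / det (G x)))"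
        by (rule matrix_vector_mult_scaleR)
      also have "G x *v (\<chi> k. det (\<chi> i j. if j = k then (\<chi> i. \<omega> (E i) x) $ i else G x $ i $ j) / det (G x)) = (\<chi> i. \<omega> (E i) x)"
        using cramer[OF D] by blast
      finally show ?thesis by simp
    qed
    define \<theta> where "\<theta> i z = \<beta> z * Z z (y i) - y i z * Z z \<beta>" for i z
    have \<theta>: "\<theta> i \<in> C\<^sub>M" for i
        unfolding \<theta>_def[abs_def]
      by (intro smooth_fun_diff smooth_fun_mult \<beta> y vf_deriv_smooth[OF Z \<beta>] vf_deriv_smooth[OF Z y])
    have \<beta>3: "(\<lambda>z. \<beta> z ^ 3) \<in> C\<^sub>M"
      unfolding power3_eq_cube by (intro smooth_fun_mult \<beta>)
    \<comment> \<open>The frame expansion of \<open>\<beta>\<^sup>3 Z\<close> holds globally with smooth coefficients, so linearity of \<open>\<omega>\<close>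
      over smooth functions transfers the identity from the frame fields to \<open>Z\<close>.\<close>
    have expand: "vf_comb (\<lambda>z. \<beta> z ^ 3) Z (\<lambda>z. 0) Z = (\<lambda>z f. \<Sum>i\<in>UNIV. \<theta> i z * E i z f)"
      using scaled_frameD(4)[OF fr vf_tangent[OF Z]] by (simp add: vf_comb_def tv_comb_def \<theta>_def)
    have "\<beta> x ^ 3 * g x (L x) (Z x) = g x (L x) (vf_comb (\<lambda>z. \<beta> z ^ 3) Z (\<lambda>z. 0) Z x)"
      using g_comb_right[OF vf_tangent[OF Z] vf_tangent[OF Z] Lx] by (simp add: vf_comb_def)
    also have "\<dots> = (\<Sum>i\<in>UNIV. \<theta> i x * g x (L x) (E i x))"
      unfolding expand by (rule g_sum_right[OF Lx]) (auto intro: Ex)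
    also have "\<dots> = d x * (\<Sum>i\<in>UNIV. \<theta> i x * \<omega> (E i) x)"
      by (simp add: LE sum_distrib_left mult_ac)
    also have "(\<Sum>i\<in>UNIV. \<theta> i x * \<omega> (E i) x) = \<omega> (vf_comb (\<lambda>z. \<beta> z ^ 3) Z (\<lambda>z. 0) Z) x"
      unfolding expand by (subst one_form_sum[OF \<omega>]) (auto intro: \<theta> E)
    also have "\<dots> = \<beta> x ^ 3 * \<omega> Z x"
      using \<omega> Z \<beta>3 smooth_fun_const[of 0] by (simp add: one_form_def)
    finally show ?thesis using \<beta>x by simp
  qed
  then show ?thesis using that[OF d L d0] by blast
qed

text \<open>
  The musical isomorphism. The local representatives \<open>L / d\<close> agree by uniqueness, which lets
  them be glued pointwise; smoothness can be checked locally.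
\<close>

lemma one_form_representation:
  assumes \<omega>: "one_form \<omega>"
  shows "\<exists>K\<in>\<XX>. \<forall>Z\<in>\<XX>. \<forall>x. g x (K x) (Z x) = \<omega> Z x"
proof -
  define R where "R x u \<longleftrightarrow> u \<in> T x \<and> (\<forall>Z\<in>\<XX>. g x u (Z x) = \<omega> Z x)" for x u
  have loc: "\<exists>d\<in>C\<^sub>M. \<exists>L\<in>\<XX>. d x\<^sub>0 \<noteq> 0 \<and> (\<forall>x. d x \<noteq> 0 \<longrightarrow> R x (tv_comb (1 / d x) (L x) 0 (L x)))" for x\<^sub>0
  proof -
    obtain d L where dL: "d \<in> C\<^sub>M" "L \<in> \<XX>" "d x\<^sub>0 \<noteq> 0"
      "\<And>x Z. d x \<noteq> 0 \<Longrightarrow> Z \<in> \<XX> \<Longrightarrow> g x (L x) (Z x) = d x * \<omega> Z x"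
      by (rule local_representative[OF \<omega>, of x\<^sub>0]) (rule that)
    have "R x (tv_comb (1 / d x) (L x) 0 (L x))" if "d x \<noteq> 0" for x
      unfolding R_def
    proof (intro conjI ballI)
      have Lx: "L x \<in> T x" by (rule vf_tangent[OF dL(2)])
      then show "tv_comb (1 / d x) (L x) 0 (L x) \<in> T x" by (rule tv_comb_tangent) (rule Lx)
      fix Z assume Z: "Z \<in> \<XX>"
      show "g x (tv_comb (1 / d x) (L x) 0 (L x)) (Z x) = \<omega> Z x"
        using g_comb_left[OF Lx Lx vf_tangent[OF Z]] dL(4)[OF that Z] that by simp
    qed
    then show ?thesis using dL by blast
  qed
  define K where "K x = (SOME u. R x u)" for x
  have K: "R x (K x)" for x
    unfolding K_def using loc[of x] by (metis someI)
  have uniq: "u = K x" if "R x u" for x u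
    using g_separates[of u x "K x"] that K[of x] by (simp add: R_def)
  have "K \<in> \<XX>"
  proof (rule vector_fieldI)
    show "K x \<in> T x" for x using K by (simp add: R_def)
    show "(\<lambda>x. K x f) \<in> C\<^sub>M" if f: "f \<in> C\<^sub>M" for f
    proof (rule smooth_fun_locally_quotient)
      fix x\<^sub>0
      obtain d L where dL: "d \<in> C\<^sub>M" "L \<in> \<XX>" "d x\<^sub>0 \<noteq> 0"
        "\<And>x. d x \<noteq> 0 \<Longrightarrow> R x (tv_comb (1 / d x) (L x) 0 (L x))"
        using loc[of x\<^sub>0] by blast
      have "K x f = L x f / d x" if "d x \<noteq> 0" for x
        using fun_cong[OF uniq[OF dL(4)[OF that]], of f] by (simp add: tv_comb_def)
      then show "\<exists>d\<in>C\<^sub>M. \<exists>l\<in>C\<^sub>M. d x\<^sub>0 \<noteq> 0 \<and> (\<forall>x. d x \<noteq> 0 \<longrightarrow> K x f = l x / d x)"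
        using dL(3) by (intro bexI[OF _ dL(1)] bexI[OF _ vf_deriv_smooth[OF dL(2) f]]) simp
    qed
  qed
  then show ?thesis using K by (auto simp: R_def)
qed

end

lemma vf_comb_apply: "vf_comb f X h Y x = tv_comb (f x) (X x) (h x) (Y x)"
  by (simp add: vf_comb_def)

context pseudo_riemannian_manifold
begin

lemma g_vf_comb:
  assumes "X \<in> \<XX>" "Y \<in> \<XX>" "Z \<in> \<XX>"
  shows g_vf_comb_left: "g x (vf_comb f X h Y x) (Z x) = f x * g x (X x) (Z x) + h x * g x (Y x) (Z x)"
    and g_vf_comb_right: "g x (Z x) (vf_comb f X h Y x) = f x * g x (Z x) (X x) + h x * g x (Z x) (Y x)"
  unfolding vf_comb_apply
  using g_comb_left[OF assms[THEN vf_tangent]] g_comb_right[OF assms[THEN vf_tangent]] by auto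

end


section \<open>The covariant derivative of the metric\<close>

locale pseudo_riemannian_connection = pseudo_riemannian_manifold A g
  for A :: "('a::{t2_space, second_countable_topology}, 'n::finite) chart set" and g +
  fixes D :: "'a connection"
  assumes connection: "linear_connection A D"
begin

lemma D_vector_field: "X \<in> \<XX> \<Longrightarrow> Y \<in> \<XX> \<Longrightarrow> D X Y \<in> \<XX>"
  using connection by (simp add: linear_connection_def)

lemma D_comb_left:
  "f \<in> C\<^sub>M \<Longrightarrow> h \<in> C\<^sub>M \<Longrightarrow> X \<in> \<XX> \<Longrightarrow> Y \<in> \<XX> \<Longrightarrow> Z \<in> \<XX> \<Longrightarrow>
    D (vf_comb f X h Y) Z = vf_comb f (D X Z) h (D Y Z)"
  using connection by (simp add: linear_connection_def)

lemma D_comb_right: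
  assumes f: "f \<in> C\<^sub>M" and h: "h \<in> C\<^sub>M" and X: "X \<in> \<XX>" and Y: "Y \<in> \<XX>" and Z: "Z \<in> \<XX>"
  shows "D X (vf_comb f Y h Z) = vf_comb (\<lambda>_. 1) (vf_comb (\<lambda>x. X x f) Y f (D X Y))
    (\<lambda>_. 1) (vf_comb (\<lambda>x. X x h) Z h (D X Z))"
proof -
  have scale: "(\<lambda>x k. f x * Y x k) \<in> \<XX>" if "f \<in> C\<^sub>M" "Y \<in> \<XX>" for f Y
    using vf_comb_vector_field[OF that(1) smooth_fun_const[of 0] that(2,2)]
    by (simp add: vf_comb_def tv_comb_def)
  have "vf_comb f Y h Z = vf_comb (\<lambda>_. 1) (\<lambda>x k. f x * Y x k) (\<lambda>_. 1) (\<lambda>x k. h x * Z x k)"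
    by (simp add: vf_comb_def tv_comb_def)
  then have "D X (vf_comb f Y h Z) =
      vf_comb (\<lambda>_. 1) (D X (\<lambda>x k. f x * Y x k)) (\<lambda>_. 1) (D X (\<lambda>x k. h x * Z x k))"
    using connection X scale[OF f Y] scale[OF h Z] by (simp add: linear_connection_def)
  then show ?thesis
    using connection X Y Z f h by (simp add: linear_connection_def deriv_along_def)
qed

abbreviation "Dg \<equiv> nabla_form D g"

lemma nabla_form_eq:
  "Dg X Y Z x = X x (\<lambda>x. g x (Y x) (Z x)) - g x (D X Y x) (Z x) - g x (Y x) (D X Z x)"
  by (simp add: nabla_form_def deriv_along_def form_apply_def)

lemma nabla_form_smooth:
  assumes "X \<in> \<XX>" "Y \<in> \<XX>" "Z \<in> \<XX>"
  shows "Dg X Y Z \<in> C\<^sub>M"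
proof -
  have "(\<lambda>x. X x (\<lambda>x. g x (Y x) (Z x)) - g x (D X Y x) (Z x) - g x (Y x) (D X Z x)) \<in> C\<^sub>M"
    by (intro smooth_fun_diff vf_deriv_smooth[OF assms(1)] g_smooth[OF assms(2,3)]
        g_smooth[OF D_vector_field[OF assms(1,2)] assms(3)]
        g_smooth[OF assms(2) D_vector_field[OF assms(1,3)]])
  then show ?thesis by (simp add: nabla_form_eq[abs_def])
qed

lemma nabla_form_sym:
  assumes "X \<in> \<XX>" "Y \<in> \<XX>" "Z \<in> \<XX>"
  shows "Dg X Y Z = Dg X Z Y"
proof
  fix x
  have sym: "g x (V x) (W x) = g x (W x) (V x)" if "V \<in> \<XX>" "W \<in> \<XX>" for V W x
    using g_sym[OF that[THEN vf_tangent]] .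
  have "(\<lambda>x. g x (Y x) (Z x)) = (\<lambda>x. g x (Z x) (Y x))"
    by (rule ext) (rule sym[OF assms(2,3)])
  then show "Dg X Y Z x = Dg X Z Y x"
    using sym[OF D_vector_field[OF assms(1,2)] assms(3), of x]
      sym[OF assms(2) D_vector_field[OF assms(1,3)], of x]
    by (simp add: nabla_form_eq)
qed

text \<open>
  Tensoriality: the terms with derivatives of \<open>f\<close> and \<open>h\<close> coming from \<open>X(g(Y, f Z + h W))\<close> and from
  the Leibniz rule of \<open>D\<close> cancel.
\<close>

lemma nabla_form_comb_right:
  assumes f: "f \<in> C\<^sub>M" and h: "h \<in> C\<^sub>M" and X: "X \<in> \<XX>" and Y: "Y \<in> \<XX>" and Z: "Z \<in> \<XX>" and W: "W \<in> \<XX>"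
  shows "Dg X Y (vf_comb f Z h W) = (\<lambda>x. f x * Dg X Y Z x + h x * Dg X Y W x)"
proof
  fix x
  note DX = D_vector_field[OF X]
  have Xx: "X x \<in> T x" by (rule vf_tangent[OF X])
  have Xf: "(\<lambda>x. X x f) \<in> C\<^sub>M" and Xh: "(\<lambda>x. X x h) \<in> C\<^sub>M"
    using vf_deriv_smooth[OF X f] vf_deriv_smooth[OF X h] .
  have gYZ: "(\<lambda>x. g x (Y x) (Z x)) \<in> C\<^sub>M" and gYW: "(\<lambda>x. g x (Y x) (W x)) \<in> C\<^sub>M"
    using g_smooth[OF Y Z] g_smooth[OF Y W] .
  have 1: "X x (\<lambda>x. g x (Y x) (vf_comb f Z h W x)) =
      f x * X x (\<lambda>x. g x (Y x) (Z x)) + g x (Y x) (Z x) * X x f +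
      (h x * X x (\<lambda>x. g x (Y x) (W x)) + g x (Y x) (W x) * X x h)"
    unfolding g_vf_comb_right[OF Z W Y]
      derivation_add[OF Xx smooth_fun_mult[OF f gYZ] smooth_fun_mult[OF h gYW]]
      derivation_mult[OF Xx f gYZ] derivation_mult[OF Xx h gYW] by simp
  have 2: "g x (D X Y x) (vf_comb f Z h W x) = f x * g x (D X Y x) (Z x) + h x * g x (D X Y x) (W x)"
    by (rule g_vf_comb_right[OF Z W DX[OF Y]])
  have 3: "g x (Y x) (D X (vf_comb f Z h W) x) =
      X x f * g x (Y x) (Z x) + f x * g x (Y x) (D X Z x) + (X x h * g x (Y x) (W x) + h x * g x (Y x) (D X W x))"
    unfolding D_comb_right[OF f h X Z W]
      g_vf_comb_right[OF vf_comb_vector_field[OF Xf f Z DX[OF Z]] vf_comb_vector_field[OF Xh h W DX[OF W]] Y]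
      g_vf_comb_right[OF Z DX[OF Z] Y] g_vf_comb_right[OF W DX[OF W] Y] by simp
  show "Dg X Y (vf_comb f Z h W) x = f x * Dg X Y Z x + h x * Dg X Y W x"
    unfolding nabla_form_eq 1 2 3 by (simp add: algebra_simps)
qed

lemma nabla_form_comb_left:
  assumes f: "f \<in> C\<^sub>M" and h: "h \<in> C\<^sub>M" and X: "X \<in> \<XX>" and Y: "Y \<in> \<XX>" and Z: "Z \<in> \<XX>" and W: "W \<in> \<XX>"
  shows "Dg (vf_comb f X h Y) Z W = (\<lambda>x. f x * Dg X Z W x + h x * Dg Y Z W x)"
proof
  fix x
  note V = D_vector_field
  have "vf_comb f X h Y x k = f x * X x k + h x * Y x k" for k
    by (simp add: vf_comb_def tv_comb_def)
  then show "Dg (vf_comb f X h Y) Z W x = f x * Dg X Z W x + h x * Dg Y Z W x"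
    unfolding nabla_form_eq D_comb_left[OF f h X Y Z] D_comb_left[OF f h X Y W]
      g_vf_comb_left[OF V[OF X Z] V[OF Y Z] W] g_vf_comb_right[OF V[OF X W] V[OF Y W] Z]
    by (simp add: algebra_simps)
qed

text \<open>
  Half of \<open>\<nabla>g\<close>, made vector-valued with the help of \<open>g\<close>. The connection \<open>D + 2 K\<close>, with \<open>K\<close>
  this tensor, is the \<open>g\<close>-dual of \<open>D\<close>, and \<open>D + K\<close> is the mean of the two.
\<close>

definition difference_tensor :: "'a connection" where
  "difference_tensor X Y =
     (SOME K. K \<in> \<XX> \<and> (\<forall>Z\<in>\<XX>. \<forall>x. g x (K x) (Z x) = (1 / 2) * Dg X Y Z x))"

lemma difference_tensor:
  assumes X: "X \<in> \<XX>" and Y: "Y \<in> \<XX>"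
  shows difference_tensor_vector_field: "difference_tensor X Y \<in> \<XX>"
    and g_difference_tensor: "Z \<in> \<XX> \<Longrightarrow> g x (difference_tensor X Y x) (Z x) = (1 / 2) * Dg X Y Z x"
proof -
  have "one_form (\<lambda>Z x. (1 / 2) * Dg X Y Z x)"
    unfolding one_form_def
  proof (intro conjI ballI)
    show "(\<lambda>x. (1 / 2) * Dg X Y Z x) \<in> C\<^sub>M" if "Z \<in> \<XX>" for Z
      by (rule smooth_fun_mult[OF smooth_fun_const nabla_form_smooth[OF X Y that]])
    show "(\<lambda>x. (1 / 2) * Dg X Y (vf_comb f Z h W) x) =
        (\<lambda>x. f x * ((1 / 2) * Dg X Y Z x) + h x * ((1 / 2) * Dg X Y W x))"
      if "Z \<in> \<XX>" "W \<in> \<XX>" "f \<in> C\<^sub>M" "h \<in> C\<^sub>M" for Z W f h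
      unfolding nabla_form_comb_right[OF that(3,4) X Y that(1,2)] by (simp add: algebra_simps)
  qed
  from one_form_representation[OF this]
  have "\<exists>K. K \<in> \<XX> \<and> (\<forall>Z\<in>\<XX>. \<forall>x. g x (K x) (Z x) = (1 / 2) * Dg X Y Z x)" by blast
  from someI_ex[OF this] show "difference_tensor X Y \<in> \<XX>"
    and "Z \<in> \<XX> \<Longrightarrow> g x (difference_tensor X Y x) (Z x) = (1 / 2) * Dg X Y Z x"
    unfolding difference_tensor_def by blast+
qed

lemma difference_tensor_comb_left:
  assumes f: "f \<in> C\<^sub>M" and h: "h \<in> C\<^sub>M" and X: "X \<in> \<XX>" and Y: "Y \<in> \<XX>" and Z: "Z \<in> \<XX>"
  shows "difference_tensor (vf_comb f X h Y) Z =
    vf_comb f (difference_tensor X Z) h (difference_tensor Y Z)"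
proof (rule vf_eqI)
  note K = difference_tensor_vector_field and XY = vf_comb_vector_field[OF f h X Y]
  show "difference_tensor (vf_comb f X h Y) Z \<in> \<XX>" by (rule K[OF XY Z])
  show "vf_comb f (difference_tensor X Z) h (difference_tensor Y Z) \<in> \<XX>"
    by (rule vf_comb_vector_field[OF f h K[OF X Z] K[OF Y Z]])
  fix W x assume W: "W \<in> \<XX>"
  show "g x (difference_tensor (vf_comb f X h Y) Z x) (W x) =
      g x (vf_comb f (difference_tensor X Z) h (difference_tensor Y Z) x) (W x)"
    unfolding g_vf_comb_left[OF K[OF X Z] K[OF Y Z] W] g_difference_tensor[OF XY Z W]
      g_difference_tensor[OF X Z W] g_difference_tensor[OF Y Z W] nabla_form_comb_left[OF f h X Y Z W]
    by (simp add: algebra_simps)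
qed

end


section \<open>The Levi-Civita connection of a Codazzi pair\<close>

locale codazzi_connection = pseudo_riemannian_connection A g D
  for A :: "('a::{t2_space, second_countable_topology}, 'n::finite) chart set" and g D +
  assumes torsion: "torsion_free A D" and codazzi: "codazzi_coupled A D g"
begin

lemma nabla_form_cyclic: "X \<in> \<XX> \<Longrightarrow> Y \<in> \<XX> \<Longrightarrow> Z \<in> \<XX> \<Longrightarrow> Dg X Y Z = Dg Z X Y"
  using codazzi by (simp add: codazzi_coupled_def)

text \<open>
  Codazzi coupling is invariance under cyclic permutations; with the symmetry of \<open>g\<close> it generates all
  permutations of the three arguments.
\<close>

lemma nabla_form_swap:
  assumes "X \<in> \<XX>" "Y \<in> \<XX>" "Z \<in> \<XX>"
  shows "Dg X Y Z = Dg Y X Z"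
  using nabla_form_cyclic[OF assms] nabla_form_sym nabla_form_cyclic assms by metis

lemma difference_tensor_sym:
  assumes "X \<in> \<XX>" "Y \<in> \<XX>"
  shows "difference_tensor X Y = difference_tensor Y X"
  by (rule vf_eqI)
     (use assms in \<open>simp_all add: difference_tensor_vector_field g_difference_tensor nabla_form_swap[of X Y]\<close>)

lemma bracket_eq:
  assumes "X \<in> \<XX>" "Y \<in> \<XX>"
  shows "lie_bracket A X Y = vf_diff (D X Y) (D Y X)"
  using torsion assms by (simp add: torsion_free_def)

definition levi_civita :: "'a connection" where
  "levi_civita X Y = vf_comb (\<lambda>_. 1) (D X Y) (\<lambda>_. 1) (difference_tensor X Y)"

lemma levi_civita_apply: "levi_civita X Y x k = D X Y x k + difference_tensor X Y x k"
  by (simp add: levi_civita_def vf_comb_def tv_comb_def)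

text \<open>
  Symmetry of the difference tensor does double duty: it leaves the torsion unchanged, and it carries
  linearity over smooth functions from the first argument to the second. The metric is parallel
  because the tensor is subtracted once in each argument of \<open>g\<close>, which takes away twice
  the half of \<open>\<nabla>g\<close>.
\<close>

lemma levi_civita_connection_levi_civita: "levi_civita_connection A g levi_civita"
  unfolding levi_civita_connection_def linear_connection_def torsion_free_def
proof (intro conjI ballI allI)
  note K = difference_tensor_vector_field
  note K_left = difference_tensor_comb_left
  have K_right: "difference_tensor X (vf_comb f Y h Z) =
      vf_comb f (difference_tensor X Y) h (difference_tensor X Z)"
    if f: "f \<in> C\<^sub>M" and h: "h \<in> C\<^sub>M" and X: "X \<in> \<XX>" and Y: "Y \<in> \<XX>" and Z: "Z \<in> \<XX>" for f h X Y Z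
    unfolding difference_tensor_sym[OF X vf_comb_vector_field[OF f h Y Z]]
      difference_tensor_sym[OF X Y] difference_tensor_sym[OF X Z] by (rule K_left[OF f h Y Z X])
  fix X Y assume X: "X \<in> \<XX>" and Y: "Y \<in> \<XX>"
  show "levi_civita X Y \<in> \<XX>"
    unfolding levi_civita_def
    by (intro vf_comb_vector_field smooth_fun_const D_vector_field K X Y)
  show "vf_diff (levi_civita X Y) (levi_civita Y X) = lie_bracket A X Y"
    unfolding bracket_eq[OF X Y] difference_tensor_sym[OF X Y]
    by (auto simp: vf_diff_def tv_comb_def levi_civita_apply fun_eq_iff difference_tensor_sym[OF X Y])
  show "levi_civita X (\<lambda>x k. f x * Y x k) = vf_comb (deriv_along X f) Y f (levi_civita X Y)"
    if f: "f \<in> C\<^sub>M" for f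
  proof -
    have fY: "(\<lambda>x k. f x * Y x k) = vf_comb f Y (\<lambda>_. 0) Y"
      by (simp add: vf_comb_def tv_comb_def)
    have "difference_tensor X (\<lambda>x k. f x * Y x k) x k = f x * difference_tensor X Y x k" for x k
      unfolding fY K_right[OF f smooth_fun_const X Y Y] by (simp add: vf_comb_def tv_comb_def)
    moreover have "D X (\<lambda>x k. f x * Y x k) = vf_comb (deriv_along X f) Y f (D X Y)"
      using connection X Y f by (simp add: linear_connection_def)
    ultimately show ?thesis
      by (auto simp: levi_civita_apply vf_comb_def tv_comb_def fun_eq_iff algebra_simps)
  qed
  fix Z assume Z: "Z \<in> \<XX>"
  show "levi_civita (vf_comb f X h Y) Z = vf_comb f (levi_civita X Z) h (levi_civita Y Z)"
    if f: "f \<in> C\<^sub>M" and h: "h \<in> C\<^sub>M" for f h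
    by (intro ext)
       (simp only: levi_civita_apply D_comb_left[OF f h X Y Z] K_left[OF f h X Y Z],
        simp add: levi_civita_apply vf_comb_def tv_comb_def algebra_simps)
  show "levi_civita X (vf_comb (\<lambda>_. a) Y (\<lambda>_. b) Z) =
      vf_comb (\<lambda>_. a) (levi_civita X Y) (\<lambda>_. b) (levi_civita X Z)" for a b
  proof -
    have Dab: "D X (vf_comb (\<lambda>_. a) Y (\<lambda>_. b) Z) = vf_comb (\<lambda>_. a) (D X Y) (\<lambda>_. b) (D X Z)"
      using connection X Y Z by (simp add: linear_connection_def)
    show ?thesis
      by (intro ext)
         (simp only: levi_civita_apply Dab K_right[OF smooth_fun_const smooth_fun_const X Y Z],
          simp add: levi_civita_apply vf_comb_def tv_comb_def algebra_simps)
  qed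
  show "nabla_form levi_civita g X Y Z = (\<lambda>x. 0)"
  proof
    fix x
    note DV = D_vector_field[OF X]
    have "g x (levi_civita X Y x) (Z x) = g x (D X Y x) (Z x) + (1 / 2) * Dg X Y Z x"
      unfolding levi_civita_def g_vf_comb_left[OF DV[OF Y] K[OF X Y] Z] g_difference_tensor[OF X Y Z] by simp
    moreover have "g x (Y x) (levi_civita X Z x) = g x (Y x) (D X Z x) + (1 / 2) * Dg X Y Z x"
      unfolding levi_civita_def g_vf_comb_right[OF DV[OF Z] K[OF X Z] Y]
        g_sym[OF vf_tangent[OF Y] vf_tangent[OF K[OF X Z]]] g_difference_tensor[OF X Z Y]
        nabla_form_sym[OF X Y Z] by simp
    ultimately show "nabla_form levi_civita g X Y Z x = 0"
      by (simp add: nabla_form_def deriv_along_def form_apply_def nabla_form_eq)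
  qed
qed

end


section \<open>Parallel symmetric endomorphisms\<close>

locale codazzi_J_connection = codazzi_connection A g D
  for A :: "('a::{t2_space, second_countable_topology}, 'n::finite) chart set" and g D +
  fixes J :: "'a endo_field"
  assumes J_tensor: "tensor_field_1_1 A J"
    and J_symmetric: "X \<in> vector_fields A \<Longrightarrow> Y \<in> vector_fields A \<Longrightarrow>
      form_apply g (endo_apply J X) Y = form_apply g X (endo_apply J Y)"
    and J_parallel: "X \<in> vector_fields A \<Longrightarrow> Y \<in> vector_fields A \<Longrightarrow> nabla_endo D J X Y = vf_zero"
begin

abbreviation "\<J> \<equiv> endo_apply J"

lemma J_vector_field: "X \<in> \<XX> \<Longrightarrow> \<J> X \<in> \<XX>"
  using J_tensor by (simp add: tensor_field_1_1_def)

lemma J_vf_comb: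
  assumes "X \<in> \<XX>" "Y \<in> \<XX>"
  shows "\<J> (vf_comb f X h Y) = vf_comb f (\<J> X) h (\<J> Y)"
  using J_tensor assms[THEN vf_tangent] by (simp add: tensor_field_1_1_def endo_apply_def vf_comb_def)

lemma vf_diff_eq_comb: "vf_diff X Y = vf_comb (\<lambda>_. 1) X (\<lambda>_. - 1) Y"
  by (simp add: vf_diff_def vf_comb_def)

lemma g_J_sym:
  assumes "X \<in> \<XX>" "Y \<in> \<XX>"
  shows "g x (\<J> X x) (Y x) = g x (X x) (\<J> Y x)"
  using fun_cong[OF J_symmetric[OF assms], of x] by (simp add: form_apply_def)

lemma D_J: assumes "X \<in> \<XX>" "Y \<in> \<XX>" shows "D X (\<J> Y) = \<J> (D X Y)"
proof (intro ext)
  fix x f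
  have "nabla_endo D J X Y x f = 0" using J_parallel[OF assms] by (simp add: vf_zero_def tv_zero_def)
  then show "D X (\<J> Y) x f = \<J> (D X Y) x f" by (simp add: nabla_endo_def vf_diff_def tv_comb_def)
qed

lemma nabla_form_J:
  assumes X: "X \<in> \<XX>" and Y: "Y \<in> \<XX>" and Z: "Z \<in> \<XX>"
  shows "Dg X (\<J> Y) Z = Dg X Y (\<J> Z)"
proof
  fix x
  note DV = D_vector_field[OF X]
  show "Dg X (\<J> Y) Z x = Dg X Y (\<J> Z) x"
    unfolding nabla_form_eq D_J[OF X Y] D_J[OF X Z] g_J_sym[OF Y Z] g_J_sym[OF DV[OF Y] Z]
      g_J_sym[OF Y DV[OF Z]] by simp
qed

text \<open>
  The cyclic symmetry carries \<open>JX\<close> from the first slot to the second, where \<open>J\<close> can pass to the other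
  argument of \<open>g\<close>.
\<close>

lemma nabla_form_J_first:
  assumes X: "X \<in> \<XX>" and Y: "Y \<in> \<XX>" and Z: "Z \<in> \<XX>"
  shows "Dg (\<J> X) Y Z = Dg X (\<J> Y) Z"
proof -
  note JX = J_vector_field[OF X] and JY = J_vector_field[OF Y]
  have "Dg (\<J> X) Y Z = Dg Z (\<J> X) Y" by (rule nabla_form_cyclic[OF JX Y Z])
  also have "\<dots> = Dg Z X (\<J> Y)" by (rule nabla_form_J[OF Z X Y])
  also have "\<dots> = Dg X (\<J> Y) Z" by (rule nabla_form_cyclic[OF X JY Z, symmetric])
  finally show ?thesis .
qed

text \<open>
  Without torsion, \<open>[Y, JX] - J[Y, X] = D\<^sub>Y JX - D\<^bsub>JX\<^esub> Y - J D\<^sub>Y X + J D\<^sub>X Y\<close>, and \<open>D\<^sub>Y JX\<close> cancels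
  \<open>J D\<^sub>Y X\<close>.
\<close>

lemma lie_derivative_J:
  assumes X: "X \<in> \<XX>" and Y: "Y \<in> \<XX>"
  shows "lie_derivative_endo A J Y X = vf_comb (\<lambda>_. 1) (\<J> (D X Y)) (\<lambda>_. - 1) (D (\<J> X) Y)"
  unfolding lie_derivative_endo_def bracket_eq[OF Y J_vector_field[OF X]] bracket_eq[OF Y X]
    vf_diff_eq_comb J_vf_comb[OF D_vector_field[OF Y X] D_vector_field[OF X Y]] D_J[OF Y X]
  by (simp add: vf_comb_def tv_comb_def)

text \<open>
  Substituting the previous lemma, the terms of the Tachibana operator regroup as
  \<open>(\<nabla>\<^bsub>JX\<^esub> g)(Y, Z) - (\<nabla>\<^sub>X g)(JY, Z)\<close>.
\<close>

lemma tachibana_zero: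
  assumes X: "X \<in> \<XX>" and Y: "Y \<in> \<XX>" and Z: "Z \<in> \<XX>"
  shows "tachibana A J g X Y Z = (\<lambda>x. 0)"
proof
  fix x
  note JX = J_vector_field[OF X] and DV = D_vector_field[OF X] and JV = J_vector_field
  note DJ = D_vector_field[OF JX]
  have "tachibana A J g X Y Z x = Dg (\<J> X) Y Z x - Dg X (\<J> Y) Z x"
    unfolding tachibana_def lie_derivative_J[OF X Y] lie_derivative_J[OF X Z] nabla_form_eq
      form_apply_def deriv_along_def g_vf_comb_left[OF JV[OF DV[OF Y]] DJ[OF Y] Z]
      g_vf_comb_right[OF JV[OF DV[OF Z]] DJ[OF Z] Y] D_J[OF X Y] g_J_sym[OF Y DV[OF Z]] by simp
  then show "tachibana A J g X Y Z x = 0"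
    using nabla_form_J_first[OF X Y Z] by simp
qed

lemma difference_tensor_J:
  assumes X: "X \<in> \<XX>" and Y: "Y \<in> \<XX>"
  shows "difference_tensor X (\<J> Y) = \<J> (difference_tensor X Y)"
proof (rule vf_eqI)
  note K = difference_tensor_vector_field[OF X] and JY = J_vector_field[OF Y]
  show "difference_tensor X (\<J> Y) \<in> \<XX>" by (rule K[OF JY])
  show "\<J> (difference_tensor X Y) \<in> \<XX>" by (rule J_vector_field[OF K[OF Y]])
  fix Z x assume Z: "Z \<in> \<XX>"
  show "g x (difference_tensor X (\<J> Y) x) (Z x) = g x (\<J> (difference_tensor X Y) x) (Z x)"
    unfolding g_J_sym[OF K[OF Y] Z] g_difference_tensor[OF X JY Z]
      g_difference_tensor[OF X Y J_vector_field[OF Z]] nabla_form_J[OF X Y Z] by simp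
qed

lemma levi_civita_J_parallel:
  assumes X: "X \<in> \<XX>" and Y: "Y \<in> \<XX>"
  shows "nabla_endo levi_civita J X Y = vf_zero"
  unfolding nabla_endo_def levi_civita_def
    J_vf_comb[OF D_vector_field[OF X Y] difference_tensor_vector_field[OF X Y]]
    D_J[OF X Y] difference_tensor_J[OF X Y]
  by (simp add: vf_diff_def vf_zero_def tv_zero_def tv_comb_def)

end


theorem theorem1:
  fixes A :: "('a::{t2_space, second_countable_topology}, 'n::finite) chart set"
    and J :: "'a endo_field"
    and g :: "'a form_field"
    and nabla :: "'a connection"
  assumes "metallic_pseudo_riemannian_manifold A J g"
    and "linear_connection A nabla"
    and "torsion_free A nabla"
    and "J_connection A J nabla"
    and "codazzi_coupled A nabla g"
  shows "(\<forall>X\<in>vector_fields A. \<forall>Y\<in>vector_fields A. \<forall>Z\<in>vector_fields A.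
            tachibana A J g X Y Z = (\<lambda>x. 0)) \<and>
         locally_metallic_pseudo_riemannian_manifold A J g"
proof -
  interpret codazzi_J_connection A g nabla J
    using assms
    by unfold_locales
      (simp_all add: metallic_pseudo_riemannian_manifold_def metallic_structure_def J_connection_def)
  show ?thesis
    unfolding locally_metallic_pseudo_riemannian_manifold_def
    using tachibana_zero assms(1) levi_civita_connection_levi_civita levi_civita_J_parallel by blast
qed

end
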